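(* Let $0<\alpha_1<\alpha_2$ and let $\nu_1,\nu_2$ be two finite measures on $\mathbf{S}_+^{d-1}$ satisfying $\int u^j\,\mathrm d\nu_i(u)=1$ for all $j\in\{1,\dots,d\}$, $i=1,2$. Let $Z_i\sim\mathcal{MS}(\alpha_i,\nu_i)$ for $i=1,2$. Let $\zeta\sim\mathcal F(\alpha_1)$ be a scalar Fréchet random variable and $\mu_{\alpha_1}$ the exponent measure of $Z_1\sim\mathcal{MS}(\alpha_1,\nu_1)$. (1) With $$C^{\mathrm K}_{\alpha_1,\alpha_2,\nu_1}=d+\sum_{j=1}^d\int_{E_0}|\log y^j|\;\mathbb{P}\big(\min(\zeta^{\alpha_2/\alpha_1},\zeta)\le y^j\big)\,\mathrm d\mu_{\alpha_1}(y),$$ one has $$\mathrm d_{\mathrm K}(Z_1,Z_2)\le C^{\mathrm K}_{\alpha_1,\alpha_2,\nu_1}\Big(\frac1{\alpha_1}+\frac1{\alpha_2}\Big)|\alpha_1-\alpha_2|+d\;\mathrm d_{\mathrm{TV}}(\nu_1,\nu_2).$$ (2) If furthermore $\alpha_1,\alpha_2>1$, then with $$C^{\mathrm W}_{\alpha_1,\alpha_2,\nu_1}=d\,\Gamma\Big(1-\frac1{\alpha_1}\Big)+\sum_{j=1}^d\int_{E_0}\max(1,y^j)\,|\log y^j|\;\mathbb{P}\big(\min(\zeta^{\alpha_2/\alpha_1},\zeta)\le y^j\big)\,\mathrm d\mu_{\alpha_1}(y),$$ one has $$\mathrm d_{\mathrm W}(Z_1,Z_2)\le C^{\mathrm W}_{\alpha_1,\alpha_2,\nu_1}\Big(\frac1{\alpha_1}+\frac1{\alpha_2}\Big)|\alpha_1-\alpha_2|+d\,\Gamma\Big(1-\frac1{\alpha_2}\Big)\mathrm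 d_{\mathrm{TV}}(\nu_1,\nu_2).$$
   Context: Fix $d\ge 1$, $\mathbb{R}_+=[0,\infty)$. Operations on vectors (powers, inequalities) are coordinate-wise; $\|x\|_1=\sum_j|x^j|$. Let $E_0=[0,\infty)^d\setminus\{0\}$, $[0,x]=\prod_j[0,x^j]$ and $[0,x]^c$ its complement in $E_0$. Fix a norm $\|\cdot\|$ on $\mathbb{R}^d$ such that $\mathbf{S}_+^{d-1}=\{x\in\mathbb{R}_+^d:\|x\|=1\}\subseteq[0,1]^d$. For $\alpha>0$ and a finite measure $\nu$ on $\mathbf{S}_+^{d-1}$ with $\int u^j\mathrm d\nu(u)=1$ for all $j$, the exponent measure $\mu$ of $\mathcal{MS}(\alpha,\nu)$ is the pushforward of $\alpha r^{-\alpha-1}\mathrm dr\otimes\nu(\mathrm du)$ on $(0,\infty)\times\mathbf{S}_+^{d-1}$ by $(r,u)\mapsto r\,u^{1/\alpha}$, and $\mathcal{MS}(\alpha,\nu)$ is the law of the max-stable random vector $Z$ on $(0,\infty)^d$ with $\mathbb{P}(Z\le z)=e^{-\mu([0,z]^c)}$, $z\in(0,\infty)^d$. $\mathcal F(\alpha)$ is the Fréchet law with c.d.f. $e^{-x^{-\alpha}}$, $x>0$. In the integrals the integrand is taken to be $0$ when $y^j=0$ (the probability vanishes there). Distances: $\mathrm d_{\mathrm K}(X,Y)=\sup_{z\in(0,\infty)^d}|\mathbb{P}(X\le z)-\mathbb{P}(Y\le z)|$; $\mathrm d_{\mathrm W}(X,Y)=\sup_h|\mathbb{E}h(X)-\mathbb{E}h(Y)|$,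 the supremum being over $h:\mathbb{R}_+^d\to\mathbb{R}$ with $|h(x)-h(y)|\le\|x-y\|_1$ for all $x,y$; $\mathrm d_{\mathrm{TV}}(\nu_1,\nu_2)=\int_{\mathbf{S}_+^{d-1}}|f_{\nu_2}-f_{\nu_1}|\,\mathrm d(\nu_1+\nu_2)$ with $f_{\nu_i}=\mathrm d\nu_i/\mathrm d(\nu_1+\nu_2)$ (i.e. the total mass of $|\nu_1-\nu_2|$). *)

theory Defs
  imports "HOL-Probability.Probability"
begin

text \<open>
  Vectors of dimension \<open>d\<close> are elements of \<^typ>\<open>real^'d\<close>, with \<open>d = CARD('d)\<close>.
  The library order on this type is coordinate-wise, so \<open>{0..z}\<close> is the box
  \<open>[0, z]\<close>, \<open>{0..}\<close> is the closed orthant and \<open>1\<close> is the all-ones vector. The strict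
  order of the library is \<open>x \<le> y \<and> \<not> y \<le> x\<close>, hence the explicit quantifier in
  \<open>pos_orthant\<close>.
\<close>

definition pos_orthant :: "(real^'d) set" where
  "pos_orthant = {x. \<forall>j. 0 < x $ j}"

definition E0 :: "(real^'d) set" where
  "E0 = {0..} - {0}"

definition l1_norm :: "real^'d \<Rightarrow> real" where
  "l1_norm x = (\<Sum>j\<in>UNIV. \<bar>x $ j\<bar>)"

definition is_norm :: "(real^'d \<Rightarrow> real) \<Rightarrow> bool" where
  "is_norm N \<longleftrightarrow>
     (\<forall>x. 0 \<le> N x) \<and> (\<forall>x. N x = 0 \<longleftrightarrow> x = 0) \<and>
     (\<forall>c x. N (c *\<^sub>R x) = \<bar>c\<bar> * N x) \<and> (\<forall>x y. N (x + y) \<le> N x + N y)"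

definition pos_sphere :: "(real^'d \<Rightarrow> real) \<Rightarrow> (real^'d) set" where
  "pos_sphere N = {x \<in> {0..}. N x = 1}"

definition angular_measure :: "(real^'d \<Rightarrow> real) \<Rightarrow> (real^'d) measure \<Rightarrow> bool" where
  "angular_measure N \<nu> \<longleftrightarrow>
     finite_measure \<nu> \<and> sets \<nu> = sets (restrict_space borel (pos_sphere N)) \<and>
     (\<forall>j. (\<integral>u. u $ j \<partial>\<nu>) = 1)"

text \<open>Since \<open>0 powr a = 0\<close>, the coordinate-wise power is correct on the faces of the orthant.\<close>

definition vpowr :: "real^'d \<Rightarrow> real \<Rightarrow> real^'d" where
  "vpowr x a = (\<chi> j. (x $ j) powr a)"

definition radial_measure :: "real \<Rightarrow> real measure" where
  "radial_measure \<alpha> =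
     density (restrict_space lborel {0<..}) (\<lambda>r. ennreal (\<alpha> * r powr (- \<alpha> - 1)))"

definition exponent_measure :: "real \<Rightarrow> (real^'d) measure \<Rightarrow> (real^'d) measure" where
  "exponent_measure \<alpha> \<nu> =
     distr (radial_measure \<alpha> \<Otimes>\<^sub>M \<nu>) (restrict_space borel E0)
       (\<lambda>(r, u). r *\<^sub>R vpowr u (1 / \<alpha>))"

text \<open>
  \<open>Z\<close> is a random vector on the probability space \<open>M\<close>, with values in the open orthant, whose law
  is \<open>MS(\<alpha>, \<nu>)\<close>. For an angular measure \<open>\<nu>\<close> the set \<open>E0 - {0..z}\<close> has finite exponent measure,
  so the real-valued \<open>measure\<close> is the right one.
\<close>

definition max_stable_vector ::
    "'a measure \<Rightarrow> ('a \<Rightarrow> real^'d) \<Rightarrow> real \<Rightarrow> (real^'d) measure \<Rightarrow> bool" where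
  "max_stable_vector M Z \<alpha> \<nu> \<longleftrightarrow>
     prob_space M \<and> Z \<in> measurable M (restrict_space borel pos_orthant) \<and>
     (\<forall>z\<in>pos_orthant.
        \<P>(\<omega> in M. Z \<omega> \<le> z) = exp (- measure (exponent_measure \<alpha> \<nu>) (E0 - {0..z})))"

definition frechet_variable :: "'a measure \<Rightarrow> ('a \<Rightarrow> real) \<Rightarrow> real \<Rightarrow> bool" where
  "frechet_variable M \<zeta> \<alpha> \<longleftrightarrow>
     prob_space M \<and> \<zeta> \<in> borel_measurable M \<and>
     (\<forall>x>0. \<P>(\<omega> in M. \<zeta> \<omega> \<le> x) = exp (- (x powr - \<alpha>)))"

text \<open>
  Distances and constants take values in \<^typ>\<open>ennreal\<close>, so that suprema and integrals of
  nonnegative functions need no boundedness or integrability side conditions.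
\<close>

definition kolmogorov_dist ::
    "'a measure \<Rightarrow> ('a \<Rightarrow> real^'d) \<Rightarrow> 'b measure \<Rightarrow> ('b \<Rightarrow> real^'d) \<Rightarrow> ennreal" where
  "kolmogorov_dist M X M' Y =
     (SUP z\<in>pos_orthant. ennreal \<bar>\<P>(\<omega> in M. X \<omega> \<le> z) - \<P>(\<omega> in M'. Y \<omega> \<le> z)\<bar>)"

text \<open>
  For vectors with values in the closed orthant: only the values of \<open>h\<close> there matter. The
  expectations are Bochner integrals, which are meaningful when the coordinates are integrable.
\<close>

definition wasserstein_dist ::
    "'a measure \<Rightarrow> ('a \<Rightarrow> real^'d) \<Rightarrow> 'b measure \<Rightarrow> ('b \<Rightarrow> real^'d) \<Rightarrow> ennreal" where
  "wasserstein_dist M X M' Y =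
     (SUP h\<in>{h :: real^'d \<Rightarrow> real. \<forall>x\<in>{0..}. \<forall>y\<in>{0..}. \<bar>h x - h y\<bar> \<le> l1_norm (x - y)}.
        ennreal \<bar>(\<integral>\<omega>. h (X \<omega>) \<partial>M) - (\<integral>\<omega>. h (Y \<omega>) \<partial>M')\<bar>)"

text \<open>The sum of two measures on the same \<open>\<sigma>\<close>-algebra.\<close>

definition add_measure :: "'a measure \<Rightarrow> 'a measure \<Rightarrow> 'a measure" where
  "add_measure M N = measure_of (space M) (sets M) (\<lambda>A. emeasure M A + emeasure N A)"

lemma space_add_measure [simp]: "space (add_measure M N) = space M"
  by (simp add: add_measure_def space_measure_of_conv)

lemma sets_add_measure [simp, measurable_cong]: "sets (add_measure M N) = sets M"
  by (simp add: add_measure_def)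

lemma emeasure_add_measure:
  assumes "sets N = sets M" and "A \<in> sets M"
  shows "emeasure (add_measure M N) A = emeasure M A + emeasure N A"
proof (rule emeasure_measure_of[OF add_measure_def])
  show "countably_additive (sets (add_measure M N)) (\<lambda>A. emeasure M A + emeasure N A)"
  proof (rule countably_additiveI)
    fix B :: "nat \<Rightarrow> 'a set"
    assume B: "range B \<subseteq> sets (add_measure M N)" "disjoint_family B"
    have "(\<Sum>i. emeasure M (B i) + emeasure N (B i))
        = (\<Sum>i. emeasure M (B i)) + (\<Sum>i. emeasure N (B i))"
      by (rule suminf_add[symmetric]) auto
    then show "(\<Sum>i. emeasure M (B i) + emeasure N (B i))
        = emeasure M (\<Union>i. B i) + emeasure N (\<Union>i. B i)"
      using B assms by (simp add: suminf_emeasure)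
  qed
qed (use assms sets.space_closed in \<open>auto simp: positive_def\<close>)

text \<open>The densities are at most 1 almost everywhere, so \<^const>\<open>enn2real\<close> loses nothing.\<close>

definition tv_dist :: "'a measure \<Rightarrow> 'a measure \<Rightarrow> ennreal" where
  "tv_dist \<nu>\<^sub>1 \<nu>\<^sub>2 =
     (let \<nu> = add_measure \<nu>\<^sub>1 \<nu>\<^sub>2 in
        \<integral>\<^sup>+ u. ennreal \<bar>enn2real (RN_deriv \<nu> \<nu>\<^sub>2 u) - enn2real (RN_deriv \<nu> \<nu>\<^sub>1 u)\<bar> \<partial>\<nu>)"

definition min_prob :: "'a measure \<Rightarrow> ('a \<Rightarrow> real) \<Rightarrow> real \<Rightarrow> real \<Rightarrow> real \<Rightarrow> real" where
  "min_prob M \<zeta> \<alpha>\<^sub>1 \<alpha>\<^sub>2 t = \<P>(\<omega> in M. min (\<zeta> \<omega> powr (\<alpha>\<^sub>2 / \<alpha>\<^sub>1)) (\<zeta> \<omega>) \<le> t)"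

definition C_K ::
    "'a measure \<Rightarrow> ('a \<Rightarrow> real) \<Rightarrow> real \<Rightarrow> real \<Rightarrow> (real^'d) measure \<Rightarrow> ennreal" where
  "C_K M \<zeta> \<alpha>\<^sub>1 \<alpha>\<^sub>2 \<nu>\<^sub>1 =
     of_nat CARD('d) +
     (\<Sum>j\<in>UNIV. \<integral>\<^sup>+ y.
        (if y $ j = 0 then 0 else ennreal (\<bar>ln (y $ j)\<bar> * min_prob M \<zeta> \<alpha>\<^sub>1 \<alpha>\<^sub>2 (y $ j)))
      \<partial>exponent_measure \<alpha>\<^sub>1 \<nu>\<^sub>1)"

definition C_W ::
    "'a measure \<Rightarrow> ('a \<Rightarrow> real) \<Rightarrow> real \<Rightarrow> real \<Rightarrow> (real^'d) measure \<Rightarrow> ennreal" where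
  "C_W M \<zeta> \<alpha>\<^sub>1 \<alpha>\<^sub>2 \<nu>\<^sub>1 =
     of_nat CARD('d) * ennreal (Gamma (1 - 1 / \<alpha>\<^sub>1)) +
     (\<Sum>j\<in>UNIV. \<integral>\<^sup>+ y.
        (if y $ j = 0 then 0
         else ennreal (max 1 (y $ j) * \<bar>ln (y $ j)\<bar> * min_prob M \<zeta> \<alpha>\<^sub>1 \<alpha>\<^sub>2 (y $ j)))
      \<partial>exponent_measure \<alpha>\<^sub>1 \<nu>\<^sub>1)"

end

theory Submission
  imports Defs
begin

text \<open>
  Write \<open>\<beta> = \<alpha>\<^sub>2 / \<alpha>\<^sub>1\<close>; the factor in the bounds is \<open>\<beta> - 1 / \<beta>\<close>. The coordinate-wise power
  \<open>Z\<^sub>1 powr (1 / \<beta>)\<close> has law \<open>MS(\<alpha>\<^sub>2, \<nu>\<^sub>1)\<close>, so it suffices to compare it with \<open>Z\<^sub>1\<close> and with \<open>Z\<^sub>2\<close>.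

  The first comparison reduces to the Frechet marginals: for the Kolmogorov distance by a union
  bound and \<open>\<bar>exp (- t) - exp (- t powr \<beta>)\<bar> \<le> \<beta> - 1 / \<beta>\<close>; for the Wasserstein distance by
  \<open>\<bar>x - x powr \<gamma>\<bar> \<le> (1 - \<gamma>) * max 1 x * \<bar>ln x\<bar>\<close>, because the density of \<open>\<zeta>\<close> with respect to the
  radial measure is its distribution function \<open>P(\<zeta> \<le> r)\<close>, which is at most
  \<open>P(min (\<zeta> powr \<beta>) \<zeta> \<le> r)\<close>.

  For the second comparison split \<open>\<nu>\<^sub>i = \<kappa> + \<rho>\<^sub>i\<close> with \<open>\<kappa>\<close> the common part of \<open>\<nu>\<^sub>1\<close> and \<open>\<nu>\<^sub>2\<close>, so that
  \<open>\<rho>\<^sub>1\<close> and \<open>\<rho>\<^sub>2\<close> have total mass \<open>d\<^sub>T\<^sub>V(\<nu>\<^sub>1, \<nu>\<^sub>2)\<close>. Up to an error of order \<open>\<epsilon>\<close> one may replace a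
  max-stable vector by its maximum with \<open>(\<epsilon>, \<dots>, \<epsilon>)\<close>, and above this level its law is that of a
  compound Poisson maximum. Hence \<open>Z\<^sub>i\<close> can be coupled with a vector \<open>W\<close> belonging to \<open>\<kappa>\<close> as
  \<open>Z\<^sub>i = max W R\<^sub>i\<close>, and the \<open>j\<close>-th coordinates differ in mean by
  \<open>(1 - c\<^sub>j powr (1 / \<alpha>)) * Gamma (1 - 1 / \<alpha>) \<le> (1 - c\<^sub>j) * Gamma (1 - 1 / \<alpha>)\<close> with
  \<open>c\<^sub>j = \<integral>u\<^sub>j \<partial>\<kappa>\<close>, where \<open>1 - c\<^sub>j\<close> is at most the total mass of \<open>\<rho>\<^sub>i\<close>.
\<close>

section \<open>The radial measure\<close>

text \<open>Closed lower orthants are stable under intersection by \<open>inf\<close>, generate the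
  Borel sets, and the sets \<open>{..n *\<^sub>R One}\<close> exhaust the space. Laws are identified
  below through their distribution functions in this way.\<close>

lemma measure_eqI_atMost:
  fixes P Q :: "'a::ordered_euclidean_space measure"
  assumes "finite_measure P" and sets: "sets P = sets borel" "sets Q = sets borel"
    and eq: "\<And>z. emeasure P {..z} = emeasure Q {..z}"
  shows "P = Q"
proof (rule measure_eqI_generator_eq)
  show "Int_stable (range atMost :: 'a set set)"
    unfolding Int_stable_def
  proof safe
    fix a b :: 'a
    have "{..a} \<inter> {..b} = {..inf a b}" by auto
    then show "{..a} \<inter> {..b} \<in> range atMost" by simp
  qed
  show "range atMost \<subseteq> Pow (UNIV :: 'a set)"
    by simp
  show "sets P = sigma_sets UNIV (range atMost)" "sets Q = sigma_sets UNIV (range atMost)"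
    using sets unfolding borel_eq_atMost by (auto simp: sets_measure_of)
  show "\<And>X. X \<in> range atMost \<Longrightarrow> emeasure P X = emeasure Q X"
    using eq by auto
  show "range (\<lambda>n::nat. {..real n *\<^sub>R One :: 'a}) \<subseteq> range atMost"
    by auto
  show "(\<Union>n::nat. {..real n *\<^sub>R One :: 'a}) = UNIV"
  proof safe
    fix x :: 'a
    obtain n :: nat where "norm x \<le> real n"
      using real_arch_simple by blast
    then have "x \<bullet> i \<le> real n" if "i \<in> Basis" for i
      using Basis_le_norm[OF that, of x] by linarith
    then have "x \<in> {..real n *\<^sub>R One}"
      by (simp add: eucl_le[where 'a='a])
    then show "x \<in> (\<Union>n::nat. {..real n *\<^sub>R One})" by blast
  qed simp
  show "\<And>n::nat. emeasure P {..real n *\<^sub>R One} \<noteq> \<infinity>"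
    using assms(1) by (simp add: finite_measure.emeasure_finite)
qed

section \<open>Tails, generators and substitution for the radial measure\<close>

lemma space_radial_measure: "space (radial_measure \<alpha>) = {0<..}"
  by (simp add: radial_measure_def space_restrict_space)

lemma sets_radial_measure: "sets (radial_measure \<alpha>) = sets (restrict_space borel {0<..})"
  by (simp add: radial_measure_def sets_restrict_space)

lemma measurable_radial_measure: "f \<in> measurable borel N \<Longrightarrow> f \<in> measurable (radial_measure \<alpha>) N"
  by (subst measurable_cong_sets[OF sets_radial_measure refl]) (rule measurable_restrict_space1)

lemma UN_greaterThan_inverse_Suc: "(\<Union>n::nat. {1 / real (Suc n)<..}) = {0<..}"
proof safe
  fix x :: real assume "0 < x"
  then show "x \<in> (\<Union>n::nat. {1 / real (Suc n)<..})"
    using nat_approx_posE[of x] by auto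
next
  fix x :: real and n :: nat assume "1 / real (Suc n) < x"
  then show "0 < x" by (meson less_trans of_nat_0_less_iff zero_less_Suc zero_less_divide_1_iff)
qed

text \<open>The density is the derivative of \<open>- (r powr - \<alpha>)\<close>, which tends to 0
  at infinity; the fundamental theorem of calculus on \<open>{a..}\<close> applies once the null set
  \<open>{a}\<close> is added.\<close>

lemma emeasure_radial_greaterThan:
  assumes "0 < \<alpha>" "0 < a"
  shows "emeasure (radial_measure \<alpha>) {a<..} = ennreal (a powr -\<alpha>)"
proof -
  have [measurable]: "{a<..} \<in> sets (restrict_space lborel {0<..})"
    using assms by (auto simp: sets_restrict_space image_iff intro!: bexI[of _ "{a<..}"])
  have "emeasure (radial_measure \<alpha>) {a<..} =
      (\<integral>\<^sup>+r. ennreal (\<alpha> * r powr (- \<alpha> - 1)) * indicator {a<..} r \<partial>restrict_space lborel {0<..})"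
    unfolding radial_measure_def by (intro emeasure_density) (auto intro!: measurable_restrict_space1)
  also have "\<dots> = (\<integral>\<^sup>+r. ennreal (\<alpha> * r powr (- \<alpha> - 1)) * indicator {a..} r \<partial>lborel)"
    using assms by (subst nn_integral_restrict_space)
      (use assms in \<open>auto intro!: nn_integral_cong_AE AE_I'[of "{a}"] simp: indicator_def of_bool_def split: if_splits\<close>)
  also have "\<dots> = ennreal (0 - (- (a powr -\<alpha>)))"
  proof (rule nn_integral_FTC_atLeast)
    fix x assume "a \<le> x"
    then have "0 < x" using assms by simp
    then show "((\<lambda>x. - (x powr - \<alpha>)) has_real_derivative \<alpha> * x powr (- \<alpha> - 1)) (at x)"
      by (auto intro!: derivative_eq_intros)
    show "0 \<le> \<alpha> * x powr (- \<alpha> - 1)" using assms by simp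
  next
    show "((\<lambda>x. - (x powr - \<alpha>)) \<longlongrightarrow> 0) at_top"
      using assms tendsto_minus[OF tendsto_neg_powr[of "-\<alpha>" "\<lambda>x. x" at_top]]
      by (simp add: filterlim_ident)
  qed simp
  finally show ?thesis by simp
qed

text \<open>Rays with positive endpoint have finite radial mass, unlike the whole half-line, so they
  form the generator on which radial measures are compared.\<close>

lemma sets_restrict_borel_greaterThan:
  "sets (restrict_space borel {0<..}) = sigma_sets {0::real<..} (greaterThan ` {0<..})" (is "?A = ?B")
proof
  have "sets borel = sigma_sets UNIV (range (greaterThan :: real \<Rightarrow> _))"
    by (subst borel_Ioi) simp
  then have "?A = sigma_sets {0::real<..} ((\<inter>) {0<..} ` range greaterThan)"
    by (simp add: sets_restrict_space) (rule sigma_sets_Int, auto intro: sigma_sets.Basic)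
  also have "\<dots> \<subseteq> ?B"
  proof (rule sigma_sets_mono, safe)
    fix a :: real
    have "{0<..} \<in> ?B" by (rule sigma_sets_top)
    moreover have "{0<..} \<inter> {a<..} = (if a \<le> 0 then {0<..} else {a<..})" by auto
    ultimately show "{0<..} \<inter> {a<..} \<in> ?B" by (auto intro: sigma_sets.Basic)
  qed
  finally show "?A \<subseteq> ?B" .
  show "?B \<subseteq> ?A"
  proof -
    have "greaterThan ` {0<..} \<subseteq> ?A"
      by (auto simp: sets_restrict_space image_iff intro!: bexI[of _ "{_<..}"])
    then show ?thesis
      using sets.sigma_sets_subset[of _ "restrict_space borel {0::real<..}"] by (simp add: space_restrict_space)
  qed
qed

lemma less_powr_neg_inverse_iff:
  fixes \<alpha> t a :: real
  assumes "0 < \<alpha>" "0 < t" "0 < a"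
  shows "a < t powr (- 1 / \<alpha>) \<longleftrightarrow> t < a powr - \<alpha>"
proof -
  have "a < t powr (- 1 / \<alpha>) \<longleftrightarrow> ln a < - ln t / \<alpha>"
    using assms by (subst ln_less_cancel_iff[symmetric]) (auto simp: ln_powr)
  also have "\<dots> \<longleftrightarrow> ln t < - \<alpha> * ln a"
    using assms by (auto simp: field_simps)
  also have "\<dots> \<longleftrightarrow> t < a powr - \<alpha>"
    using assms by (subst (2) ln_less_cancel_iff[symmetric]) (auto simp: ln_powr)
  finally show ?thesis .
qed

text \<open>The map \<open>t powr (- 1 / \<alpha>)\<close> is decreasing and pulls the ray
  \<open>{a<..}\<close> back to the interval from 0 to \<open>a powr - \<alpha>\<close>, whose
  length is the radial mass of the ray. Radial integrals thus become Lebesgue integrals on the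
  positive half-line.\<close>

lemma radial_measure_eq_distr:
  assumes "0 < \<alpha>"
  shows "radial_measure \<alpha> =
    distr (restrict_space lborel {0<..}) (restrict_space borel {0<..}) (\<lambda>t. t powr (- 1 / \<alpha>))"
    (is "_ = distr ?L ?B ?f")
proof (rule measure_eqI_generator_eq)
  have f: "?f \<in> measurable ?L ?B"
    by (intro measurable_restrict_space2 measurable_restrict_space1) (auto simp: space_restrict_space)
  show "Int_stable (greaterThan ` {0::real<..})"
    unfolding Int_stable_def
  proof safe
    fix a b :: real assume "0 < a" "0 < b"
    then have "{a<..} \<inter> {b<..} = {max a b<..}" "0 < max a b" by auto
    then show "{a<..} \<inter> {b<..} \<in> greaterThan ` {0<..}" by (auto simp del: max_less_iff_conj)
  qed
  show "greaterThan ` {0::real<..} \<subseteq> Pow {0<..}" by auto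
  show "sets (radial_measure \<alpha>) = sigma_sets {0<..} (greaterThan ` {0<..})"
    "sets (distr ?L ?B ?f) = sigma_sets {0<..} (greaterThan ` {0<..})"
    by (simp_all add: sets_radial_measure sets_restrict_borel_greaterThan)
  show "range (\<lambda>n::nat. {1 / real (Suc n)<..}) \<subseteq> greaterThan ` {0::real<..}"
    by auto
  show "(\<Union>n::nat. {1 / real (Suc n)<..}) = {0<..}"
    by (rule UN_greaterThan_inverse_Suc)
  show "\<And>n::nat. emeasure (radial_measure \<alpha>) {1 / real (Suc n)<..} \<noteq> \<infinity>"
    using assms by (simp add: emeasure_radial_greaterThan)
  fix X :: "real set" assume "X \<in> greaterThan ` {0<..}"
  then obtain a where a: "0 < a" "X = {a<..}" by auto
  then have X: "X \<in> sets ?B"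
    by (auto simp: sets_restrict_borel_greaterThan intro: sigma_sets.Basic)
  have "emeasure (distr ?L ?B ?f) X = emeasure ?L (?f -` X \<inter> space ?L)"
    using f X by (rule emeasure_distr)
  also have "?f -` X \<inter> space ?L = {0<..<a powr -\<alpha>}"
    using less_powr_neg_inverse_iff[OF assms _ a(1)] a by (auto simp: space_restrict_space)
  also have "emeasure ?L \<dots> = ennreal (a powr - \<alpha>)"
    by (subst emeasure_restrict_space) auto
  finally show "emeasure (radial_measure \<alpha>) X = emeasure (distr ?L ?B ?f) X"
    using a assms by (simp add: emeasure_radial_greaterThan)
qed

lemma nn_integral_radial_measure:
  assumes "0 < \<alpha>" and f: "f \<in> borel_measurable borel"
  shows "(\<integral>\<^sup>+r. f r \<partial>radial_measure \<alpha>) =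
    (\<integral>\<^sup>+t. f (t powr (- 1 / \<alpha>)) * indicator {0<..} t \<partial>lborel)"
proof -
  have "(\<lambda>t. t powr (- 1 / \<alpha>)) \<in> measurable (restrict_space lborel {0<..}) (restrict_space borel {0<..})"
    by (intro measurable_restrict_space2 measurable_restrict_space1) (auto simp: space_restrict_space)
  then have "(\<integral>\<^sup>+r. f r \<partial>radial_measure \<alpha>) =
    (\<integral>\<^sup>+t. f (t powr (- 1 / \<alpha>)) \<partial>restrict_space lborel {0<..})"
    unfolding radial_measure_eq_distr[OF assms(1)] using f
    by (intro nn_integral_distr) (auto intro: measurable_restrict_space1)
  then show ?thesis by (simp add: nn_integral_restrict_space)
qed

lemma sigma_finite_radial_measure:
  assumes "0 < \<alpha>" shows "sigma_finite_measure (radial_measure \<alpha>)"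
proof
  show "\<exists>A. countable A \<and> A \<subseteq> sets (radial_measure \<alpha>) \<and>
        \<Union>A = space (radial_measure \<alpha>) \<and> (\<forall>a\<in>A. emeasure (radial_measure \<alpha>) a \<noteq> \<infinity>)"
  proof (intro exI[of _ "range (\<lambda>n::nat. {1 / real (Suc n)<..})"] conjI)
    show "range (\<lambda>n::nat. {1 / real (Suc n)<..}) \<subseteq> sets (radial_measure \<alpha>)"
      by (auto simp: sets_radial_measure sets_restrict_borel_greaterThan intro!: sigma_sets.Basic)
    show "(\<Union>n::nat. {1 / real (Suc n)<..}) = space (radial_measure \<alpha>)"
      unfolding space_radial_measure by (rule UN_greaterThan_inverse_Suc)
  qed (auto simp: emeasure_radial_greaterThan assms)
qed

section \<open>Frechet variables\<close>

text \<open>The distribution function is prescribed only at positive arguments, so positivity has to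
  be recovered from its limit at 0.\<close>

lemma frechet_variable_pos:
  assumes X: "frechet_variable M X \<alpha>" and \<alpha>: "0 < \<alpha>"
  shows "AE \<omega> in M. 0 < X \<omega>"
proof -
  interpret prob_space M using X by (simp add: frechet_variable_def)
  have [measurable]: "X \<in> borel_measurable M" using X by (simp add: frechet_variable_def)
  have "prob {\<omega>\<in>space M. X \<omega> \<le> 0} \<le> 0 + e" if "0 < e" for e
  proof -
    \<comment> \<open>This level satisfies \<open>y powr \<alpha> = e\<close>, so the probability
      below it is \<open>exp (- inverse e)\<close>, which is at most \<open>e\<close>.\<close>
    define y where "y = e powr (1 / \<alpha>)"
    have y: "0 < y" "y powr \<alpha> = e" using that \<alpha> by (auto simp: y_def powr_powr)
    have "prob {\<omega>\<in>space M. X \<omega> \<le> 0} \<le> prob {\<omega>\<in>space M. X \<omega> \<le> y}"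
      using y by (intro finite_measure_mono) auto
    also have "\<dots> = exp (- (y powr - \<alpha>))"
      using X y by (simp add: frechet_variable_def)
    also have "\<dots> = 1 / exp (inverse e)"
      using y by (simp add: powr_minus exp_minus field_simps)
    also have "\<dots> \<le> 1 / inverse e"
      using that exp_ge_add_one_self[of "inverse e"] by (intro divide_left_mono; simp; linarith)
    finally show ?thesis by (simp add: divide_inverse)
  qed
  then have "prob {\<omega>\<in>space M. X \<omega> \<le> 0} \<le> 0"
    by (rule field_le_epsilon)
  then have "prob {\<omega>\<in>space M. X \<omega> \<le> 0} = 0"
    using measure_nonneg[of M] by (meson antisym)
  then have "{\<omega>\<in>space M. X \<omega> \<le> 0} \<in> null_sets M"
    by (auto simp: null_sets_def emeasure_eq_measure)
  then show ?thesis by (rule AE_I') auto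
qed

text \<open>Differentiating \<open>exp (- (r powr - \<alpha>))\<close> gives the same function times
  the density of the radial measure: relative to that measure, the Frechet density is its own
  distribution function. This links Frechet expectations to integrals against the exponent
  measure.\<close>

lemma frechet_variable_distr:
  assumes X: "frechet_variable M X \<alpha>" and \<alpha>: "0 < \<alpha>"
  shows "distr M borel X =
    distr (density (radial_measure \<alpha>) (\<lambda>r. ennreal (exp (- (r powr - \<alpha>))))) borel (\<lambda>r. r)"
    (is "_ = ?D")
proof (rule measure_eqI_atMost)
  interpret prob_space M using X by (simp add: frechet_variable_def)
  have [measurable]: "X \<in> borel_measurable M" using X by (simp add: frechet_variable_def)
  note [measurable] = measurable_radial_measure[where N=borel]
  have [measurable]: "{..x} \<inter> {0<..} \<in> sets (radial_measure \<alpha>)" for x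
    unfolding sets_radial_measure sets_restrict_space by (rule image_eqI[of _ _ "{..x}"]) auto
  show "finite_measure (distr M borel X)"
    by (rule finite_measure_distr) simp
  fix x :: real
  \<comment> \<open>Under \<open>r = t powr (- 1 / \<alpha>)\<close> the weight becomes
    \<open>exp (- t)\<close>; the domain is \<open>t \<ge> x powr - \<alpha>\<close> for positive
    \<open>x\<close> and empty otherwise.\<close>
  have *: "emeasure ?D {..x} = (\<integral>\<^sup>+t. ennreal (exp (- t)) * indicator {t. t powr (- 1 / \<alpha>) \<le> x} t *
      indicator {0<..} t \<partial>lborel)"
  proof -
    have "emeasure ?D {..x} = emeasure (density (radial_measure \<alpha>) (\<lambda>r. ennreal (exp (- (r powr - \<alpha>)))))
       ({..x} \<inter> {0<..})"
      by (subst emeasure_distr) (auto simp: space_radial_measure vimage_def)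
    also have "\<dots> = (\<integral>\<^sup>+r. ennreal (exp (- (r powr - \<alpha>))) * indicator {..x} r \<partial>radial_measure \<alpha>)"
      by (subst emeasure_density) (auto intro!: nn_integral_cong simp: space_radial_measure indicator_def)
    also have "\<dots> = (\<integral>\<^sup>+t. ennreal (exp (- ((t powr (- 1 / \<alpha>)) powr - \<alpha>))) *
        indicator {..x} (t powr (- 1 / \<alpha>)) * indicator {0<..} t \<partial>lborel)"
      by (rule nn_integral_radial_measure) (use \<alpha> in auto)
    also have "\<dots> = (\<integral>\<^sup>+t. ennreal (exp (- t)) * indicator {t. t powr (- 1 / \<alpha>) \<le> x} t *
      indicator {0<..} t \<partial>lborel)"
      using \<alpha> by (intro nn_integral_cong) (auto simp: indicator_def powr_powr)
    finally show ?thesis .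
  qed
  show "emeasure (distr M borel X) {..x} = emeasure ?D {..x}"
  proof (cases "0 < x")
    case True
    have "emeasure (distr M borel X) {..x} = emeasure M {\<omega>\<in>space M. X \<omega> \<le> x}"
      by (subst emeasure_distr) (auto simp: vimage_def Int_def conj_commute)
    also have "\<dots> = ennreal (exp (- (x powr - \<alpha>)))"
      using X True by (simp add: emeasure_eq_measure frechet_variable_def)
    also have "\<dots> = ennreal (0 - (- exp (- (x powr - \<alpha>))))" by simp
    also have "\<dots> = (\<integral>\<^sup>+t. ennreal (exp (- t)) * indicator {x powr - \<alpha>..} t \<partial>lborel)"
    proof (rule nn_integral_FTC_atLeast[symmetric])
      show "((\<lambda>t. - exp (- t)) \<longlongrightarrow> (0::real)) at_top"
        using tendsto_minus[OF filterlim_compose[OF exp_at_bot filterlim_uminus_at_bot_at_top]] by simp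
    qed (auto intro!: derivative_eq_intros)
    also have "\<dots> = emeasure ?D {..x}"
      unfolding *
    proof (intro nn_integral_cong)
      fix t :: real
      have "0 < x powr - \<alpha>" using True by simp
      then have "0 < t" if "x powr - \<alpha> \<le> t" using that by linarith
      then show "ennreal (exp (- t)) * indicator {x powr - \<alpha>..} t =
         ennreal (exp (- t)) * indicator {t. t powr (- 1 / \<alpha>) \<le> x} t * indicator {0<..} t"
        using less_powr_neg_inverse_iff[OF \<alpha> _ True, of t]
        by (cases "0 < t") (auto simp: indicator_def not_less)
    qed
    finally show ?thesis .
  next
    case False
    have "emeasure M {\<omega>\<in>space M. X \<omega> \<le> x} = 0"
      using frechet_variable_pos[OF X \<alpha>] False
      by (intro emeasure_eq_0_AE) (auto elim!: eventually_mono)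
    then have "emeasure (distr M borel X) {..x} = 0"
      by (subst emeasure_distr) (auto simp: vimage_def Int_def conj_commute)
    moreover have neg: "\<not> t powr (- 1 / \<alpha>) \<le> x" if "0 < t" for t
      using False that powr_gt_zero[of t "- 1 / \<alpha>"] by linarith
    have "emeasure ?D {..x} = (\<integral>\<^sup>+t. 0 \<partial>(lborel :: real measure))"
      unfolding * by (intro nn_integral_cong) (use neg in \<open>auto simp: indicator_def\<close>)
    ultimately show ?thesis by simp
  qed
qed simp_all

lemma frechet_variable_nn_integral:
  assumes X: "frechet_variable M X \<alpha>" and \<alpha>: "0 < \<alpha>" and f[measurable]: "f \<in> borel_measurable borel"
  shows "(\<integral>\<^sup>+\<omega>. f (X \<omega>) \<partial>M) = (\<integral>\<^sup>+r. f r * ennreal (exp (- (r powr - \<alpha>))) \<partial>radial_measure \<alpha>)"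
proof -
  have [measurable]: "X \<in> borel_measurable M" using X by (simp add: frechet_variable_def)
  note [measurable] = measurable_radial_measure[where N=borel]
  have "(\<integral>\<^sup>+\<omega>. f (X \<omega>) \<partial>M) = (\<integral>\<^sup>+x. f x \<partial>distr M borel X)"
    by (simp add: nn_integral_distr)
  also have "\<dots> = (\<integral>\<^sup>+r. f r * ennreal (exp (- (r powr - \<alpha>))) \<partial>radial_measure \<alpha>)"
    unfolding frechet_variable_distr[OF X \<alpha>]
    by (simp add: nn_integral_distr nn_integral_density mult.commute)
  finally show ?thesis .
qed

lemma frechet_variable_expectation:
  assumes X: "frechet_variable M X \<alpha>" and \<alpha>: "1 < \<alpha>"
  shows "integrable M X" and "(\<integral>\<omega>. X \<omega> \<partial>M) = Gamma (1 - 1 / \<alpha>)"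
proof -
  have [measurable]: "X \<in> borel_measurable M" using X by (simp add: frechet_variable_def)
  have "(\<integral>\<^sup>+\<omega>. ennreal (X \<omega>) \<partial>M) =
      (\<integral>\<^sup>+r. ennreal r * ennreal (exp (- (r powr - \<alpha>))) \<partial>radial_measure \<alpha>)"
    using X \<alpha> by (intro frechet_variable_nn_integral) auto
  also have "\<dots> = (\<integral>\<^sup>+t. ennreal (t powr (- 1 / \<alpha>)) * ennreal (exp (- ((t powr (- 1 / \<alpha>)) powr - \<alpha>))) *
        indicator {0<..} t \<partial>lborel)"
    using \<alpha> by (intro nn_integral_radial_measure) auto
  \<comment> \<open>Euler's integral for Gamma at \<open>1 - 1 / \<alpha>\<close>, an argument that
    is positive because \<open>1 < \<alpha>\<close>.\<close>
  also have "\<dots> = (\<integral>\<^sup>+t. ennreal (indicator {0..} t * t powr ((1 - 1 / \<alpha>) - 1) / exp t) \<partial>lborel)"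
    using \<alpha> by (intro nn_integral_cong)
      (auto simp: indicator_def powr_powr exp_minus field_simps simp flip: ennreal_mult)
  also have "\<dots> = ennreal (Gamma (1 - 1 / \<alpha>))"
    using \<alpha> by (subst Gamma_conv_nn_integral_real) auto
  finally have *: "(\<integral>\<^sup>+\<omega>. ennreal (X \<omega>) \<partial>M) = ennreal (Gamma (1 - 1 / \<alpha>))" .
  have "AE \<omega> in M. 0 \<le> X \<omega>"
    using frechet_variable_pos[OF X] \<alpha> by (auto elim!: eventually_mono)
  moreover have "0 \<le> Gamma (1 - 1 / \<alpha>)"
    using \<alpha> by (intro less_imp_le Gamma_real_pos) auto
  ultimately show "integrable M X" and "(\<integral>\<omega>. X \<omega> \<partial>M) = Gamma (1 - 1 / \<alpha>)"
    using * by (subst (asm) nn_integral_eq_integrable; simp)+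
qed

text \<open>The larger of \<open>x\<close> and \<open>x powr \<gamma>\<close> is at most
  \<open>max 1 x\<close>. Factoring it out leaves \<open>1 - exp (- s)\<close> with
  \<open>s = (1 - \<gamma>) * \<bar>ln x\<bar>\<close>, and this is at most
  \<open>s\<close>.\<close>

lemma abs_diff_powr_le:
  fixes x \<gamma> :: real
  assumes "0 < x" "0 \<le> \<gamma>" "\<gamma> \<le> 1"
  shows "\<bar>x - x powr \<gamma>\<bar> \<le> (1 - \<gamma>) * (max 1 x * \<bar>ln x\<bar>)"
proof (cases "1 \<le> x")
  case True
  have "x powr \<gamma> = x * exp (- ((1 - \<gamma>) * ln x))"
    using assms by (simp add: powr_def mult_exp_exp exp_ln_iff[THEN iffD2, symmetric] algebra_simps exp_diff)
  then have "x - x powr \<gamma> = x * (1 - exp (- ((1 - \<gamma>) * ln x)))"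
    by (simp add: algebra_simps)
  also have "\<dots> \<le> x * ((1 - \<gamma>) * ln x)"
    using assms exp_ge_add_one_self[of "- ((1 - \<gamma>) * ln x)"] by (intro mult_left_mono) auto
  finally have "x - x powr \<gamma> \<le> (1 - \<gamma>) * (x * ln x)" by (simp add: algebra_simps)
  moreover have "x powr \<gamma> \<le> x powr 1" using True assms by (intro powr_mono) auto
  ultimately show ?thesis using True by (simp add: max_def)
next
  case False
  have "x = x powr \<gamma> * exp ((1 - \<gamma>) * ln x)"
    using assms by (simp add: powr_def mult_exp_exp algebra_simps)
  then have "x powr \<gamma> - x = x powr \<gamma> * (1 - exp ((1 - \<gamma>) * ln x))"
    by (simp add: algebra_simps)
  also have "\<dots> \<le> 1 * (- ((1 - \<gamma>) * ln x))"
  proof (intro mult_mono)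
    show "x powr \<gamma> \<le> 1" using False assms by (intro powr_le1) auto
    show "1 - exp ((1 - \<gamma>) * ln x) \<le> - ((1 - \<gamma>) * ln x)"
      using exp_ge_add_one_self[of "(1 - \<gamma>) * ln x"] by linarith
    show "0 \<le> 1 - exp ((1 - \<gamma>) * ln x)"
      using False assms by (simp add: mult_nonneg_nonpos)
  qed auto
  finally have "x powr \<gamma> - x \<le> (1 - \<gamma>) * (- ln x)" by simp
  moreover have "x powr 1 \<le> x powr \<gamma>" using False assms by (intro powr_mono') auto
  ultimately show ?thesis using False assms by (simp add: max_def)
qed

lemma frechet_variable_powr_distance:
  assumes X: "frechet_variable M X \<alpha>" and \<alpha>: "0 < \<alpha>" and \<gamma>: "0 \<le> \<gamma>" "\<gamma> \<le> 1"
  shows "(\<integral>\<^sup>+\<omega>. ennreal \<bar>X \<omega> - X \<omega> powr \<gamma>\<bar> \<partial>M) \<le>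
    ennreal (1 - \<gamma>) * (\<integral>\<^sup>+r. ennreal (max 1 r * \<bar>ln r\<bar> * exp (- (r powr - \<alpha>))) \<partial>radial_measure \<alpha>)"
proof -
  have [measurable]: "X \<in> borel_measurable M" using X by (simp add: frechet_variable_def)
  have "(\<integral>\<^sup>+\<omega>. ennreal \<bar>X \<omega> - X \<omega> powr \<gamma>\<bar> \<partial>M) \<le>
      (\<integral>\<^sup>+\<omega>. ennreal (1 - \<gamma>) * ennreal (max 1 (X \<omega>) * \<bar>ln (X \<omega>)\<bar>) \<partial>M)"
    using frechet_variable_pos[OF X \<alpha>] \<gamma>
    by (intro nn_integral_mono_AE)
      (auto elim!: eventually_mono simp: abs_diff_powr_le simp flip: ennreal_mult intro!: ennreal_leI)
  also have "\<dots> = ennreal (1 - \<gamma>) * (\<integral>\<^sup>+\<omega>. ennreal (max 1 (X \<omega>) * \<bar>ln (X \<omega>)\<bar>) \<partial>M)"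
    by (rule nn_integral_cmult) simp
  also have "(\<integral>\<^sup>+\<omega>. ennreal (max 1 (X \<omega>) * \<bar>ln (X \<omega>)\<bar>) \<partial>M) =
    (\<integral>\<^sup>+r. ennreal (max 1 r * \<bar>ln r\<bar>) * ennreal (exp (- (r powr - \<alpha>))) \<partial>radial_measure \<alpha>)"
    by (rule frechet_variable_nn_integral[OF X \<alpha>]) simp
  finally show ?thesis by (simp add: ennreal_mult'')
qed

text \<open>Mean value theorem in the exponent: with \<open>w = t powr s\<close> and
  \<open>s \<ge> 1\<close>, the derivative of \<open>exp (- (t powr s))\<close> in \<open>s\<close>
  is at most \<open>exp (- w) * w * \<bar>ln w\<bar>\<close> in modulus, and this is at most 1. So
  the difference is at most \<open>\<beta> - 1\<close>, hence at most
  \<open>\<beta> - 1 / \<beta>\<close>.\<close>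

lemma exp_neg_powr_diff_le:
  fixes t \<beta> :: real
  assumes "0 < t" "1 \<le> \<beta>"
  shows "\<bar>exp (- t) - exp (- (t powr \<beta>))\<bar> \<le> \<beta> - 1 / \<beta>"
proof -
  define g where "g s = exp (- (t powr s))" for s
  have g': "(g has_real_derivative - (exp (- (t powr s)) * (t powr s * ln t))) (at s)" for s
    unfolding g_def using assms by (auto intro!: derivative_eq_intros)
  have w: "\<bar>exp (- w) * (w * ln w)\<bar> \<le> 1" if "0 < w" for w :: real
  proof (cases "1 \<le> w")
    case True
    have "w * ln w \<le> w * (w - 1)" using True ln_le_minus_one[of w] by (intro mult_left_mono) auto
    also have "\<dots> \<le> w\<^sup>2" using True by (simp add: power2_eq_square algebra_simps)
    also have "\<dots> \<le> (exp (w / 2))\<^sup>2"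
    proof (rule power_mono)
      \<comment> \<open>The Taylor polynomial \<open>1 + w / 2 + w^2 / 8\<close> exceeds
        \<open>w\<close> by \<open>(w - 2)^2 / 8 + 1 / 2\<close>.\<close>
      have "0 \<le> (w - 2)\<^sup>2 / 8" by simp
      then have "w \<le> 1 + w / 2 + (w / 2)\<^sup>2 / 2" by (simp add: power2_eq_square field_simps)
      also have "\<dots> \<le> exp (w / 2)" using that by (intro exp_lower_Taylor_quadratic) simp
      finally show "w \<le> exp (w / 2)" .
    qed (use that in simp)
    also have "\<dots> = exp w" by (simp flip: exp_double)
    finally show ?thesis using True by (simp add: exp_minus field_simps abs_mult)
  next
    case False
    \<comment> \<open>For \<open>w\<close> below 1, \<open>- ln w = ln (1 / w)\<close> is at most
      \<open>1 / w - 1\<close>.\<close>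
    have "w * (- ln w) \<le> w * (1 / w - 1)"
      using that ln_le_minus_one[of "1 / w"] by (intro mult_left_mono) (auto simp: ln_div)
    also have "\<dots> \<le> 1" using that by (simp add: field_simps)
    also have "1 \<le> exp w" using that by simp
    finally show ?thesis using False that by (simp add: exp_minus field_simps abs_mult)
  qed
  show ?thesis
  proof (cases "\<beta> = 1")
    case False
    then have "1 < \<beta>" using assms by simp
    then obtain s where s: "1 < s" "s < \<beta>"
      "g \<beta> - g 1 = (\<beta> - 1) * - (exp (- (t powr s)) * (t powr s * ln t))"
      using MVT2[of 1 \<beta> g, OF _ g'] by blast
    \<comment> \<open>Here \<open>\<bar>ln t\<bar>\<close> is enlarged to
      \<open>s * \<bar>ln t\<bar> = \<bar>ln (t powr s)\<bar>\<close>, using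
      \<open>1 < s\<close>.\<close>
    have "\<bar>exp (- (t powr s)) * (t powr s * ln t)\<bar> \<le> \<bar>exp (- (t powr s)) * (t powr s * ln (t powr s))\<bar>"
      using s assms by (auto simp: abs_mult ln_powr intro!: mult_left_mono)
        (metis abs_ge_zero less_imp_le mult_le_cancel_right1 not_less)
    also have "\<dots> \<le> 1" using w[of "t powr s"] assms by simp
    finally have "\<bar>g \<beta> - g 1\<bar> \<le> (\<beta> - 1) * 1"
      unfolding s(3) abs_mult[of "\<beta> - 1"] abs_minus_cancel using \<open>1 < \<beta>\<close> by (intro mult_mono) auto
    also have "(\<beta> - 1) * 1 \<le> \<beta> - 1 / \<beta>" using \<open>1 < \<beta>\<close> by simp
    finally have "\<bar>g 1 - g \<beta>\<bar> \<le> \<beta> - 1 / \<beta>"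
      by (subst abs_minus_commute)
    then show ?thesis using assms by (simp add: g_def)
  qed (use assms in simp)
qed

section \<open>Exponent measures\<close>

lemma borel_measurable_vec_lambda:
  fixes f :: "'a \<Rightarrow> 'd::finite \<Rightarrow> real"
  assumes "\<And>j. (\<lambda>x. f x j) \<in> borel_measurable M"
  shows "(\<lambda>x. \<chi> j. f x j) \<in> borel_measurable M"
  by (subst borel_measurable_euclidean_space) (auto simp: Basis_vec_def inner_axis assms)

lemma borel_measurable_vec_nth [measurable]: "(\<lambda>x :: real^'d. x $ j) \<in> borel_measurable borel"
  by (intro borel_measurable_continuous_onI continuous_intros)

lemma borel_measurable_vpowr: "(\<lambda>x :: real^'d. vpowr x a) \<in> borel_measurable borel"
  unfolding vpowr_def by (intro borel_measurable_vec_lambda) simp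

lemma vec_le_iff: "(x :: real^'d) \<le> y \<longleftrightarrow> (\<forall>j. x $ j \<le> y $ j)"
  by (simp add: less_eq_vec_def)

lemma ex_pos_vec:
  fixes u :: "real^'d" assumes "0 \<le> u" "u \<noteq> 0" shows "\<exists>j. 0 < u $ j"
  using assms by (auto simp: vec_eq_iff vec_le_iff order_less_le)

text \<open>For positive \<open>z\<close> and nonzero \<open>u\<close> in the orthant this is the
  radial mass of the radii \<open>r\<close> at which
  \<open>r *\<^sub>R vpowr u (1 / \<alpha>)\<close> is outside \<open>{0..z}\<close>: coordinate
  \<open>j\<close> exceeds \<open>z $ j\<close> exactly when \<open>r powr - \<alpha>\<close> is
  below \<open>u $ j * (z $ j) powr - \<alpha>\<close>.\<close>

definition max_weight :: "real \<Rightarrow> real^'d \<Rightarrow> real^'d \<Rightarrow> real" where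
  "max_weight \<alpha> z u = (MAX j. u $ j * (z $ j) powr - \<alpha>)"

text \<open>For positive \<open>z\<close> and a spherical measure this is the exponent measure of
  the complement of the box, see \<open>emeasure_exponent_measure\<close>. In this form it is
  visibly additive in \<open>\<rho>\<close>, so splitting the angular measure splits the exponent of
  the distribution function.\<close>

definition tail_integral :: "real \<Rightarrow> (real^'d) measure \<Rightarrow> real^'d \<Rightarrow> real" where
  "tail_integral \<alpha> \<rho> z = (\<integral>u. max_weight \<alpha> z u \<partial>\<rho>)"

lemma borel_measurable_max_weight [measurable]: "max_weight \<alpha> z \<in> borel_measurable borel"
  unfolding max_weight_def[abs_def] by (intro borel_measurable_Max) auto

lemma max_weight_ge: "u $ j * (z $ j) powr - \<alpha> \<le> max_weight \<alpha> z u"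
  by (simp add: max_weight_def)

lemma max_weight_nonneg:
  assumes "0 \<le> u" shows "0 \<le> max_weight \<alpha> z u"
proof -
  have "0 \<le> u $ j * (z $ j) powr - \<alpha>" for j using assms by (simp add: vec_le_iff)
  then show ?thesis using max_weight_ge order_trans by blast
qed

lemma max_weight_le:
  "(\<And>j. u $ j * (z $ j) powr - \<alpha> \<le> b) \<Longrightarrow> max_weight \<alpha> z u \<le> b"
  by (auto simp: max_weight_def)

lemma less_max_weight_iff: "b < max_weight \<alpha> z u \<longleftrightarrow> (\<exists>j. b < u $ j * (z $ j) powr - \<alpha>)"
  by (auto simp: max_weight_def Max_gr_iff)

lemma powr_neg_inverse_less_iff:
  fixes \<alpha> t a :: real
  assumes "0 < \<alpha>" "0 < t" "0 < a"
  shows "t powr (- 1 / \<alpha>) < a \<longleftrightarrow> a powr - \<alpha> < t"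
proof -
  have "t powr (- 1 / \<alpha>) < a \<longleftrightarrow> - ln t / \<alpha> < ln a"
    using assms by (subst ln_less_cancel_iff[symmetric]) (auto simp: ln_powr)
  also have "\<dots> \<longleftrightarrow> - \<alpha> * ln a < ln t"
    using assms by (auto simp: field_simps)
  also have "\<dots> \<longleftrightarrow> a powr - \<alpha> < t"
    using assms by (subst (2) ln_less_cancel_iff[symmetric]) (auto simp: ln_powr)
  finally show ?thesis .
qed

lemma less_scaled_powr_iff:
  fixes r u z \<alpha> :: real
  assumes "0 < \<alpha>" "0 < r" "0 \<le> u" "0 < z"
  shows "z < r * u powr (1 / \<alpha>) \<longleftrightarrow> r powr - \<alpha> < u * z powr - \<alpha>"
proof (cases "u = 0")
  case False
  then have "z < r * u powr (1 / \<alpha>) \<longleftrightarrow> ln z < ln r + ln u / \<alpha>"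
    using assms by (subst ln_less_cancel_iff[symmetric]) (auto simp: ln_mult ln_powr)
  also have "\<dots> \<longleftrightarrow> - \<alpha> * ln r < ln u + - \<alpha> * ln z"
    using assms by (auto simp: field_simps)
  also have "\<dots> \<longleftrightarrow> r powr - \<alpha> < u * z powr - \<alpha>"
    using assms False by (subst (2) ln_less_cancel_iff[symmetric]) (auto simp: ln_mult ln_powr)
  finally show ?thesis .
qed (use assms in simp)

text \<open>The radial measure is homogeneous: replacing \<open>t\<close> by
  \<open>c powr \<alpha> * t\<close> absorbs the scaling. The condition \<open>f 0 = 0\<close>
  settles \<open>c = 0\<close>, where both sides vanish.\<close>

lemma nn_integral_radial_measure_scale:
  assumes \<alpha>: "0 < \<alpha>" and f[measurable]: "f \<in> borel_measurable borel" and "f 0 = 0" and c: "0 \<le> c"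
  shows "(\<integral>\<^sup>+r. f (r * c) \<partial>radial_measure \<alpha>) = ennreal (c powr \<alpha>) * (\<integral>\<^sup>+r. f r \<partial>radial_measure \<alpha>)"
proof (cases "c = 0")
  case False
  then have c: "0 < c" using c by simp
  have "(\<integral>\<^sup>+r. f (r * c) \<partial>radial_measure \<alpha>) =
      (\<integral>\<^sup>+t. f (t powr (- 1 / \<alpha>) * c) * indicator {0<..} t \<partial>lborel)"
    by (rule nn_integral_radial_measure[OF \<alpha>]) simp
  also have "\<dots> = ennreal \<bar>c powr \<alpha>\<bar> * (\<integral>\<^sup>+t. f ((0 + c powr \<alpha> * t) powr (- 1 / \<alpha>) * c) *
      indicator {0<..} (0 + c powr \<alpha> * t) \<partial>lborel)"
    using c by (intro nn_integral_real_affine) auto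
  also have "(\<integral>\<^sup>+t. f ((0 + c powr \<alpha> * t) powr (- 1 / \<alpha>) * c) * indicator {0<..} (0 + c powr \<alpha> * t) \<partial>lborel) =
      (\<integral>\<^sup>+t. f (t powr (- 1 / \<alpha>)) * indicator {0<..} t \<partial>lborel)"
  proof (intro nn_integral_cong)
    fix t :: real
    have "(0 + c powr \<alpha> * t) powr (- 1 / \<alpha>) * c = t powr (- 1 / \<alpha>)" if "0 < t"
      using c \<alpha> that by (simp add: powr_mult powr_powr powr_minus field_simps)
    then show "f ((0 + c powr \<alpha> * t) powr (- 1 / \<alpha>) * c) * indicator {0<..} (0 + c powr \<alpha> * t) =
        f (t powr (- 1 / \<alpha>)) * indicator {0<..} t"
      using c by (auto simp: indicator_def zero_less_mult_iff)
  qed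
  also have "\<dots> = (\<integral>\<^sup>+r. f r \<partial>radial_measure \<alpha>)"
    by (rule nn_integral_radial_measure[OF \<alpha>, symmetric]) simp
  finally show ?thesis by simp
qed (use assms in simp)

text \<open>No normalisation of first moments is imposed, so the locale covers angular measures and
  also their common part and remainders. The bounds \<open>0 \<le> u \<le> 1\<close> give
  integrability, and \<open>u \<noteq> 0\<close> keeps the polar image inside
  \<open>E0\<close>.\<close>

locale spherical_measure = finite_measure \<rho> for \<rho> :: "(real^'d) measure" +
  fixes S :: "(real^'d) set"
  assumes sets_eq: "sets \<rho> = sets (restrict_space borel S)"
    and S_subset: "S \<subseteq> {0..1} - {0}"
begin

lemma space_eq: "space \<rho> = S"
  using sets_eq_imp_space_eq[OF sets_eq] by (simp add: space_restrict_space)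

lemma measurable_borel: "f \<in> measurable borel N \<Longrightarrow> f \<in> measurable \<rho> N"
  by (subst measurable_cong_sets[OF sets_eq refl]) (rule measurable_restrict_space1)

lemma space_D:
  assumes "u \<in> space \<rho>"
  shows "0 \<le> u" "u \<noteq> 0" "0 \<le> u $ j" "u $ j \<le> 1"
  using assms S_subset by (auto simp: space_eq vec_le_iff)

lemma integrable_nth: "integrable \<rho> (\<lambda>u. u $ j)"
  by (rule integrable_const_bound[where B=1]) (auto intro!: AE_I2 measurable_borel simp: space_D)

lemma integrable_max_weight: "integrable \<rho> (max_weight \<alpha> z)"
proof (rule integrable_const_bound[where B="\<Sum>j\<in>UNIV. (z $ j) powr - \<alpha>"])
  show "AE u in \<rho>. norm (max_weight \<alpha> z u) \<le> (\<Sum>j\<in>UNIV. (z $ j) powr - \<alpha>)"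
  proof (rule AE_I2)
    fix u assume u: "u \<in> space \<rho>"
    have "max_weight \<alpha> z u \<le> (\<Sum>j\<in>UNIV. (z $ j) powr - \<alpha>)"
    proof (rule max_weight_le)
      fix j
      have "u $ j * (z $ j) powr - \<alpha> \<le> 1 * (z $ j) powr - \<alpha>"
        using space_D[OF u] by (intro mult_right_mono) auto
      also have "\<dots> \<le> (\<Sum>j\<in>UNIV. (z $ j) powr - \<alpha>)"
        unfolding mult_1 by (rule member_le_sum) auto
      finally show "u $ j * (z $ j) powr - \<alpha> \<le> (\<Sum>j\<in>UNIV. (z $ j) powr - \<alpha>)" .
    qed
    then show "norm (max_weight \<alpha> z u) \<le> (\<Sum>j\<in>UNIV. (z $ j) powr - \<alpha>)"
      using max_weight_nonneg[OF space_D(1)[OF u]] by simp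
  qed
qed (intro measurable_borel borel_measurable_max_weight)

lemma measurable_polar [measurable]:
  "(\<lambda>(r, u). r *\<^sub>R vpowr u (1 / \<alpha>)) \<in> measurable (radial_measure \<alpha>' \<Otimes>\<^sub>M \<rho>) (restrict_space borel E0)"
proof (rule measurable_restrict_space2)
  have [measurable]: "fst \<in> borel_measurable (radial_measure \<alpha>' \<Otimes>\<^sub>M \<rho>)"
    by (rule measurable_compose[OF measurable_fst]) (simp add: measurable_radial_measure)
  have [measurable]: "(\<lambda>x. vpowr (snd x) (1 / \<alpha>)) \<in> borel_measurable (radial_measure \<alpha>' \<Otimes>\<^sub>M \<rho>)"
    by (rule measurable_compose[OF measurable_snd]) (intro measurable_borel borel_measurable_vpowr)
  show "(\<lambda>(r, u). r *\<^sub>R vpowr u (1 / \<alpha>)) \<in> borel_measurable (radial_measure \<alpha>' \<Otimes>\<^sub>M \<rho>)"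
    unfolding split_beta by simp
  show "(\<lambda>(r, u). r *\<^sub>R vpowr u (1 / \<alpha>)) \<in> space (radial_measure \<alpha>' \<Otimes>\<^sub>M \<rho>) \<rightarrow> E0"
  proof safe
    fix r u assume "(r, u) \<in> space (radial_measure \<alpha>' \<Otimes>\<^sub>M \<rho>)"
    then have *: "0 < r" "u \<in> space \<rho>" by (auto simp: space_pair_measure space_radial_measure)
    obtain j where "0 < u $ j" using ex_pos_vec[OF space_D(1,2)] * by blast
    then have "0 < (r *\<^sub>R vpowr u (1 / \<alpha>)) $ j" using * by (simp add: vpowr_def)
    then have "r *\<^sub>R vpowr u (1 / \<alpha>) \<noteq> 0" by (metis less_irrefl zero_index)
    moreover have "0 \<le> r *\<^sub>R vpowr u (1 / \<alpha>)" using * by (simp add: vec_le_iff vpowr_def)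
    ultimately show "r *\<^sub>R vpowr u (1 / \<alpha>) \<in> E0" by (simp add: E0_def)
  qed
qed

lemma sets_exponent_measure: "sets (exponent_measure \<alpha> \<rho>) = sets (restrict_space borel E0)"
  by (simp add: exponent_measure_def)

lemma box_complement_sets: "E0 - {0..z} \<in> sets (restrict_space borel E0)"
  unfolding sets_restrict_space by (rule image_eqI[of _ _ "- {0..z}"]) (auto intro: borel_comp)

text \<open>Fubini with the direction \<open>u\<close> outside: for fixed \<open>u\<close> the radii
  leaving the box form the ray beyond \<open>max_weight \<alpha> z u powr (- 1 / \<alpha>)\<close>,
  whose radial mass is \<open>max_weight \<alpha> z u\<close>.\<close>

lemma emeasure_exponent_measure:
  assumes \<alpha>: "0 < \<alpha>" and z: "z \<in> pos_orthant"
  shows "emeasure (exponent_measure \<alpha> \<rho>) (E0 - {0..z}) = ennreal (tail_integral \<alpha> \<rho> z)"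
proof -
  interpret R: sigma_finite_measure "radial_measure \<alpha>" by (rule sigma_finite_radial_measure[OF \<alpha>])
  interpret P: pair_sigma_finite "radial_measure \<alpha>" \<rho> ..
  let ?T = "\<lambda>(r, u). r *\<^sub>R vpowr u (1 / \<alpha>)"
  let ?A = "?T -` (E0 - {0..z}) \<inter> space (radial_measure \<alpha> \<Otimes>\<^sub>M \<rho>)"
  have A: "?A \<in> sets (radial_measure \<alpha> \<Otimes>\<^sub>M \<rho>)"
    by (rule measurable_sets[OF measurable_polar box_complement_sets])
  have "emeasure (exponent_measure \<alpha> \<rho>) (E0 - {0..z}) = emeasure (radial_measure \<alpha> \<Otimes>\<^sub>M \<rho>) ?A"
    unfolding exponent_measure_def by (rule emeasure_distr[OF measurable_polar box_complement_sets])
  also have "\<dots> = (\<integral>\<^sup>+u. emeasure (radial_measure \<alpha>) ((\<lambda>r. (r, u)) -` ?A) \<partial>\<rho>)"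
    by (rule P.emeasure_pair_measure_alt2[OF A])
  also have "\<dots> = (\<integral>\<^sup>+u. ennreal (max_weight \<alpha> z u) \<partial>\<rho>)"
  proof (rule nn_integral_cong)
    fix u assume u: "u \<in> space \<rho>"
    let ?K = "max_weight \<alpha> z u"
    \<comment> \<open>A nonzero direction has a positive coordinate, hence positive weight.
      Positivity matters: \<open>0 powr (- 1 / \<alpha>)\<close> is 0 by convention, not
      infinity.\<close>
    obtain j where "0 < u $ j" using ex_pos_vec[OF space_D(1,2)] u by blast
    moreover have "z $ j \<noteq> 0" using z by (auto simp: pos_orthant_def dest: spec[of _ j])
    ultimately have K: "0 < ?K"
      by (auto simp: less_max_weight_iff intro!: exI[of _ j])
    have section_iff: "(r, u) \<in> ?A \<longleftrightarrow> r \<in> {?K powr (- 1 / \<alpha>)<..}" for r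
    proof (cases "0 < r")
      case True
      have "(r, u) \<in> space (radial_measure \<alpha> \<Otimes>\<^sub>M \<rho>)"
        using True u by (simp add: space_pair_measure space_radial_measure)
      moreover from this have "?T (r, u) \<in> E0"
        using measurable_space[OF measurable_polar] by (auto simp: space_restrict_space)
      ultimately have "(r, u) \<in> ?A \<longleftrightarrow> (\<exists>j. z $ j < r * (u $ j) powr (1 / \<alpha>))"
        by (auto simp: E0_def vec_le_iff vpowr_def not_le)
      also have "\<dots> \<longleftrightarrow> r powr - \<alpha> < ?K"
        using z True \<alpha> space_D(3)[OF u]
        by (simp add: less_max_weight_iff less_scaled_powr_iff pos_orthant_def)
      also have "\<dots> \<longleftrightarrow> ?K powr (- 1 / \<alpha>) < r"
        using powr_neg_inverse_less_iff[of \<alpha> ?K r] True K \<alpha> by simp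
      finally show ?thesis by simp
    next
      case False
      then show ?thesis
        using powr_ge_zero[of ?K "- 1 / \<alpha>"]
        by (auto simp: space_pair_measure space_radial_measure simp del: powr_ge_zero)
    qed
    have "(\<lambda>r. (r, u)) -` ?A = {?K powr (- 1 / \<alpha>)<..}"
      by (rule set_eqI) (subst vimage_eq, rule section_iff)
    then show "emeasure (radial_measure \<alpha>) ((\<lambda>r. (r, u)) -` ?A) = ennreal ?K"
      using K \<alpha> by (simp add: emeasure_radial_greaterThan powr_powr)
  qed
  also have "\<dots> = ennreal (tail_integral \<alpha> \<rho> z)"
    unfolding tail_integral_def
    by (intro nn_integral_eq_integral integrable_max_weight AE_I2) (auto intro: max_weight_nonneg space_D)
  finally show ?thesis .
qed

lemma tail_integral_nonneg: "0 \<le> tail_integral \<alpha> \<rho> z"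
  unfolding tail_integral_def by (intro integral_nonneg_AE AE_I2 max_weight_nonneg space_D(1))

lemma measure_exponent_measure:
  assumes "0 < \<alpha>" and "z \<in> pos_orthant"
  shows "measure (exponent_measure \<alpha> \<rho>) (E0 - {0..z}) = tail_integral \<alpha> \<rho> z"
  using emeasure_exponent_measure[OF assms] by (simp add: measure_def tail_integral_nonneg)

text \<open>By Fubini and homogeneity with \<open>c = (u $ j) powr (1 / \<alpha>)\<close>, the inner
  integral scales by \<open>u $ j\<close>. For unit first moments the \<open>j\<close>-th marginal
  of the exponent measure is therefore the radial measure, away from the face
  \<open>y $ j = 0\<close>, which \<open>f 0 = 0\<close> discards.\<close>

lemma nn_integral_exponent_measure_nth:
  assumes \<alpha>: "0 < \<alpha>" and f[measurable]: "f \<in> borel_measurable borel" and "f 0 = 0"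
  shows "(\<integral>\<^sup>+y. f (y $ j) \<partial>exponent_measure \<alpha> \<rho>) =
    ennreal (\<integral>u. u $ j \<partial>\<rho>) * (\<integral>\<^sup>+r. f r \<partial>radial_measure \<alpha>)"
proof -
  interpret R: sigma_finite_measure "radial_measure \<alpha>" by (rule sigma_finite_radial_measure[OF \<alpha>])
  interpret P: pair_sigma_finite "radial_measure \<alpha>" \<rho> ..
  let ?T = "\<lambda>(r, u). r *\<^sub>R vpowr u (1 / \<alpha>)"
  have m: "(\<lambda>y. f (y $ j)) \<in> borel_measurable (restrict_space borel E0)"
    by (intro measurable_restrict_space1) measurable
  have mT: "(\<lambda>x. f (?T x $ j)) \<in> borel_measurable (radial_measure \<alpha> \<Otimes>\<^sub>M \<rho>)"
    using measurable_compose[OF measurable_polar m] by simp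
  have "(\<integral>\<^sup>+y. f (y $ j) \<partial>exponent_measure \<alpha> \<rho>) =
      (\<integral>\<^sup>+x. f (?T x $ j) \<partial>(radial_measure \<alpha> \<Otimes>\<^sub>M \<rho>))"
    unfolding exponent_measure_def using m by (intro nn_integral_distr) auto
  also have "\<dots> = (\<integral>\<^sup>+u. \<integral>\<^sup>+r. f (?T (r, u) $ j) \<partial>radial_measure \<alpha> \<partial>\<rho>)"
    by (rule P.nn_integral_snd[OF mT, symmetric])
  also have "\<dots> = (\<integral>\<^sup>+u. ennreal (u $ j) * (\<integral>\<^sup>+r. f r \<partial>radial_measure \<alpha>) \<partial>\<rho>)"
    using \<alpha> \<open>f 0 = 0\<close> space_D(3)
    by (intro nn_integral_cong)
      (simp add: vpowr_def nn_integral_radial_measure_scale powr_powr)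
  also have "\<dots> = (\<integral>\<^sup>+u. ennreal (u $ j) \<partial>\<rho>) * (\<integral>\<^sup>+r. f r \<partial>radial_measure \<alpha>)"
    by (intro nn_integral_multc measurable_borel) simp
  also have "(\<integral>\<^sup>+u. ennreal (u $ j) \<partial>\<rho>) = ennreal (\<integral>u. u $ j \<partial>\<rho>)"
    by (intro nn_integral_eq_integral integrable_nth AE_I2 space_D(3))
  finally show ?thesis .
qed

text \<open>The other coordinates of the threshold tend to infinity. As \<open>u \<le> 1\<close>,
  the maximum lies between its \<open>j\<close>-th term and that term plus
  \<open>real (Suc n) powr - \<alpha>\<close>; integrating gives the sandwich.\<close>

lemma tail_integral_marginal:
  assumes \<alpha>: "0 < \<alpha>" and x: "0 < x"
  shows "(\<lambda>n. tail_integral \<alpha> \<rho> (\<chi> i. if i = j then x else real (Suc n))) \<longlonglongrightarrow> (\<integral>u. u $ j \<partial>\<rho>) * x powr - \<alpha>"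
proof (rule real_tendsto_sandwich)
  let ?z = "\<lambda>n. \<chi> i. if i = j then x else real (Suc n)"
  let ?b = "\<lambda>n. (\<integral>u. u $ j \<partial>\<rho>) * x powr - \<alpha> + measure \<rho> (space \<rho>) * real (Suc n) powr - \<alpha>"
  show "\<forall>\<^sub>F n in sequentially. (\<integral>u. u $ j \<partial>\<rho>) * x powr - \<alpha> \<le> tail_integral \<alpha> \<rho> (?z n)"
  proof (intro always_eventually allI)
    fix n
    have "(\<integral>u. u $ j * x powr - \<alpha> \<partial>\<rho>) \<le> tail_integral \<alpha> \<rho> (?z n)"
      unfolding tail_integral_def
      by (intro integral_mono integrable_max_weight integrable_mult_left integrable_nth)
        (use max_weight_ge[of _ j "?z n"] in simp)
    then show "(\<integral>u. u $ j \<partial>\<rho>) * x powr - \<alpha> \<le> tail_integral \<alpha> \<rho> (?z n)" by simp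
  qed
  show "\<forall>\<^sub>F n in sequentially. tail_integral \<alpha> \<rho> (?z n) \<le> ?b n"
  proof (intro always_eventually allI)
    fix n
    have "tail_integral \<alpha> \<rho> (?z n) \<le> (\<integral>u. u $ j * x powr - \<alpha> + real (Suc n) powr - \<alpha> \<partial>\<rho>)"
      unfolding tail_integral_def
    proof (intro integral_mono integrable_max_weight Bochner_Integration.integrable_add
        integrable_mult_left integrable_nth integrable_const max_weight_le)
      fix u i assume u: "u \<in> space \<rho>"
      have 1: "u $ i * real (Suc n) powr - \<alpha> \<le> 1 * real (Suc n) powr - \<alpha>"
        using space_D[OF u] by (intro mult_right_mono) auto
      have 2: "0 \<le> u $ j * x powr - \<alpha>" using space_D[OF u] by simp
      show "u $ i * (?z n $ i) powr - \<alpha> \<le> u $ j * x powr - \<alpha> + real (Suc n) powr - \<alpha>"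
      proof (cases "i = j")
        case False
        then have "?z n $ i = real (Suc n)" by simp
        then show ?thesis using 1 2 by (simp only:)
      qed simp
    qed
    also have "\<dots> = ?b n"
      by (subst Bochner_Integration.integral_add)
        (auto intro!: integrable_mult_left integrable_nth)
    finally show "tail_integral \<alpha> \<rho> (?z n) \<le> ?b n" .
  qed
  have "(\<lambda>n. real (Suc n) powr - \<alpha>) \<longlonglongrightarrow> 0"
    using \<alpha> by (intro tendsto_neg_powr filterlim_compose[OF filterlim_real_sequentially filterlim_Suc]) auto
  then have "?b \<longlonglongrightarrow> (\<integral>u. u $ j \<partial>\<rho>) * x powr - \<alpha> + measure \<rho> (space \<rho>) * 0"
    by (intro tendsto_intros)
  then show "?b \<longlonglongrightarrow> (\<integral>u. u $ j \<partial>\<rho>) * x powr - \<alpha>" by simp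
qed simp

text \<open>Continuity from below along boxes whose other sides grow. The distribution function is
  assumed only above level \<open>\<epsilon>\<close>: the value 0 serves max-stable vectors, a
  positive value their truncations.\<close>

lemma marginal_cdf:
  assumes P: "prob_space P" "sets P = sets borel" and \<alpha>: "0 < \<alpha>"
    and cdf: "\<And>z. (\<And>i. \<epsilon> \<le> z $ i) \<Longrightarrow> z \<in> pos_orthant \<Longrightarrow> measure P {..z} = exp (- tail_integral \<alpha> \<rho> z)"
    and x: "0 < x" "\<epsilon> \<le> x"
  shows "measure P {w. w $ j \<le> x} = exp (- ((\<integral>u. u $ j \<partial>\<rho>) * x powr - \<alpha>))"
proof -
  interpret P: prob_space P by fact
  let ?z = "\<lambda>n. (\<chi> i. if i = j then x else real (Suc n)) :: real^'d"
  have *: "(\<Union>n. {..?z n}) = {w. w $ j \<le> x}"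
  proof (intro equalityI subsetI)
    fix w assume w: "w \<in> {w. w $ j \<le> x}"
    obtain n :: nat where n: "norm w \<le> real n" using real_arch_simple by blast
    have "w $ i \<le> real (Suc n)" for i
      using n component_le_norm_cart[of w i] by simp
    then have "w \<in> {..?z n}" using w by (auto simp: vec_le_iff)
    then show "w \<in> (\<Union>n. {..?z n})" by blast
  qed (auto simp: vec_le_iff split: if_splits dest: spec[of _ j])
  have "(\<lambda>n. measure P {..?z n}) \<longlonglongrightarrow> measure P (\<Union>n. {..?z n})"
    by (rule P.finite_Lim_measure_incseq) (auto simp: P(2) incseq_def vec_le_iff intro: order_trans)
  moreover have "eventually (\<lambda>n. measure P {..?z n} = exp (- tail_integral \<alpha> \<rho> (?z n))) sequentially"
  proof -
    obtain m :: nat where m: "\<epsilon> \<le> real m" using real_arch_simple by blast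
    show ?thesis
    proof (rule eventually_sequentiallyI[of m])
      fix n assume "m \<le> n"
      then show "measure P {..?z n} = exp (- tail_integral \<alpha> \<rho> (?z n))"
        using m x by (intro cdf) (auto simp: pos_orthant_def)
    qed
  qed
  ultimately have "(\<lambda>n. exp (- tail_integral \<alpha> \<rho> (?z n))) \<longlonglongrightarrow> measure P {w. w $ j \<le> x}"
    unfolding * by (rule Lim_transform_eventually)
  moreover have "(\<lambda>n. exp (- tail_integral \<alpha> \<rho> (?z n))) \<longlonglongrightarrow> exp (- ((\<integral>u. u $ j \<partial>\<rho>) * x powr - \<alpha>))"
    by (intro tendsto_intros tail_integral_marginal \<alpha> x)
  ultimately show ?thesis by (rule LIMSEQ_unique)
qed

end

lemma angular_measure_spherical:
  assumes "is_norm N" "pos_sphere N \<subseteq> {0..1}" "angular_measure N \<nu>"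
  shows "spherical_measure \<nu> (pos_sphere N)"
proof -
  have "N 0 = 0" using assms(1) by (simp add: is_norm_def)
  then have "0 \<notin> pos_sphere N" by (simp add: pos_sphere_def)
  then show ?thesis
    using assms by (auto simp: spherical_measure_def spherical_measure_axioms_def angular_measure_def)
qed

section \<open>Poisson maxima and Lipschitz functionals\<close>

definition vmax :: "real^'d \<Rightarrow> real^'d \<Rightarrow> real^'d" where
  "vmax x y = (\<chi> j. max (x $ j) (y $ j))"

lemma vmax_nth [simp]: "vmax x y $ j = max (x $ j) (y $ j)"
  by (simp add: vmax_def)

lemma vmax_le_iff: "vmax x y \<le> z \<longleftrightarrow> x \<le> z \<and> y \<le> z"
  by (auto simp: vec_le_iff)

lemma borel_measurable_vmax [measurable (raw)]:
  assumes [measurable]: "f \<in> borel_measurable M" "g \<in> borel_measurable M"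
  shows "(\<lambda>x. vmax (f x) (g x :: real^'d)) \<in> borel_measurable M"
  unfolding vmax_def by (rule borel_measurable_vec_lambda) measurable

lemma pred_ge_vec [measurable]: "Measurable.pred borel (\<lambda>w :: real^'d. e \<le> w)"
  unfolding pred_def by (simp flip: atLeast_def)

text \<open>The law of the maximum of \<open>e\<close> and \<open>k\<close> independent vectors with
  law \<open>Q\<close>. Starting from \<open>e\<close> keeps the law above the truncation level for
  every \<open>k\<close>, including 0.\<close>

primrec max_iid :: "real^'d \<Rightarrow> (real^'d) measure \<Rightarrow> nat \<Rightarrow> (real^'d) measure" where
  "max_iid e Q 0 = return borel e"
| "max_iid e Q (Suc k) = distr (max_iid e Q k \<Otimes>\<^sub>M Q) borel (\<lambda>(x, y). vmax x y)"

lemma sets_max_iid [measurable_cong]: "sets (max_iid e Q k) = sets borel"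
  by (cases k) auto

lemma max_iid:
  assumes Q: "prob_space Q" and sets[measurable_cong]: "sets Q = sets borel"
  shows "prob_space (max_iid e Q k)" "AE w in max_iid e Q k. e \<le> w"
    "e \<le> z \<Longrightarrow> emeasure (max_iid e Q k) {..z} = emeasure Q {..z} ^ k"
proof (induction k)
  case 0
  { case 1 show ?case by (simp add: prob_space_return) }
  { case 2 show ?case unfolding max_iid.simps using AE_return[OF _ pred_ge_vec, of e e] by simp }
  { case 3 then show ?case by simp }
next
  case (Suc k)
  interpret Q: prob_space Q by fact
  interpret K: prob_space "max_iid e Q k" by (rule Suc)
  interpret KQ: pair_prob_space "max_iid e Q k" Q ..
  have [measurable]: "(\<lambda>(x, y). vmax x y) \<in> borel_measurable (max_iid e Q k \<Otimes>\<^sub>M Q)"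
    unfolding split_beta by measurable
  { case 1 show ?case by (simp add: KQ.prob_space_distr) }
  { case 2
    have "AE w in max_iid e Q k \<Otimes>\<^sub>M Q. e \<le> fst w"
    proof (rule KQ.AE_pair_measure)
      show "{w \<in> space (max_iid e Q k \<Otimes>\<^sub>M Q). e \<le> fst w} \<in> sets (max_iid e Q k \<Otimes>\<^sub>M Q)"
        by measurable
      show "AE x in max_iid e Q k. AE y in Q. e \<le> fst (x, y)"
        using Suc(2) by (rule eventually_mono) simp
    qed
    then have "AE w in max_iid e Q k \<Otimes>\<^sub>M Q. e \<le> (case w of (x, y) \<Rightarrow> vmax x y)"
      by (rule eventually_mono) (auto simp: vec_le_iff max.coboundedI1)
    then show ?case unfolding max_iid.simps by (subst AE_distr_iff) (auto simp: split_beta) }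
  { case 3
    have "emeasure (max_iid e Q (Suc k)) {..z} = emeasure (max_iid e Q k \<Otimes>\<^sub>M Q) ({..z} \<times> {..z})"
      by (simp add: emeasure_distr) (auto intro!: arg_cong[where f="emeasure _"]
        simp: space_pair_measure vmax_le_iff sets_eq_imp_space_eq[OF sets] sets_eq_imp_space_eq[OF sets_max_iid])
    also have "\<dots> = emeasure (max_iid e Q k) {..z} * emeasure Q {..z}"
      by (rule Q.emeasure_pair_measure_Times) (auto simp: sets sets_max_iid)
    finally show ?case using Suc(3)[OF 3] by (simp add: mult.commute) }
qed

text \<open>The witness is the law of the maximum of \<open>e\<close> and a Poisson number of independent vectors
  with the normalised law of \<open>m\<close>.\<close>

lemma compound_poisson_max:
  fixes m :: "(real^'d) measure"
  assumes "finite_measure m" and sets[measurable_cong]: "sets m = sets borel"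
  shows "\<exists>P. prob_space P \<and> sets P = sets borel \<and> (AE w in P. e \<le> w) \<and>
    (\<forall>z. e \<le> z \<longrightarrow> measure P {..z} = exp (- measure m (- {..z})))"
proof -
  interpret m: finite_measure m by fact
  have space: "space m = UNIV" using sets_eq_imp_space_eq[OF sets] by simp
  define r where "r = measure m UNIV"
  show ?thesis
  proof (cases "r = 0")
    case True
    \<comment> \<open>An intensity without mass cannot be normalised; the point mass at
      \<open>e\<close> is the witness then.\<close>
    have "measure m A = 0" for A
      using m.bounded_measure[of A] True by (intro antisym) (simp_all add: space r_def)
    then show ?thesis
      by (intro exI[of _ "return borel e"]) (auto simp: prob_space_return AE_return[OF _ pred_ge_vec] measure_return)
  next
    case False
    then have r: "0 < r" by (simp add: r_def zero_less_measure_iff)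
    define Q where "Q = density m (\<lambda>_. ennreal (1 / r))"
    have setsQ: "sets Q = sets borel" by (simp add: Q_def sets)
    have emQ: "emeasure Q A = ennreal (measure m A / r)" if "A \<in> sets borel" for A
      using that r by (simp add: Q_def emeasure_density_const sets m.emeasure_eq_measure divide_inverse mult.commute flip: ennreal_mult)
    have Q: "prob_space Q"
      by (rule prob_spaceI) (use r emQ[of UNIV] in \<open>simp add: sets_eq_imp_space_eq[OF setsQ] r_def\<close>)
    note K = max_iid[OF Q setsQ]
    define P where "P = measure_pmf (poisson_pmf r) \<bind> max_iid e Q"
    have K_meas: "max_iid e Q \<in> measurable (measure_pmf (poisson_pmf r)) (subprob_algebra borel)"
      using K(1) by (auto simp: space_subprob_algebra sets_max_iid prob_space_imp_subprob_space)
    have P: "prob_space P"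
      unfolding P_def by (rule measure_pmf.prob_space_bind[OF _ K_meas]) (simp add: K(1))
    have setsP: "sets P = sets borel"
      unfolding P_def by (subst sets_bind[OF K_meas[THEN sets_kernel]]) auto
    have AE: "AE w in P. e \<le> w"
      unfolding P_def by (subst AE_bind[OF K_meas]) (auto simp: K(2))
    have "measure P {..z} = exp (- measure m (- {..z}))" if "e \<le> z" for z
    proof -
      interpret P: prob_space P by fact
      define q where "q = measure m {..z} / r"
      have q: "0 \<le> q" using r by (simp add: q_def)
      have "emeasure P {..z} = (\<integral>\<^sup>+k. emeasure (max_iid e Q k) {..z} \<partial>measure_pmf (poisson_pmf r))"
        unfolding P_def by (rule emeasure_bind[OF _ K_meas]) auto
      also have "\<dots> = (\<integral>\<^sup>+k. ennreal (q ^ k) \<partial>measure_pmf (poisson_pmf r))"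
        using K(3)[OF that] q by (simp add: emQ q_def ennreal_power)
      also have "\<dots> = (\<Sum>k. ennreal (r ^ k / fact k * exp (- r) * q ^ k))"
        using r q by (simp add: nn_integral_measure_pmf nn_integral_count_space_nat flip: ennreal_mult)
      \<comment> \<open>The generating function of the Poisson law with mean \<open>r\<close>,
        evaluated at \<open>q\<close>.\<close>
      also have "\<dots> = ennreal (exp (- r) * exp (r * q))"
      proof (rule suminf_ennreal_eq)
        have "(\<lambda>k. exp (- r) * ((r * q) ^ k /\<^sub>R fact k)) sums (exp (- r) * exp (r * q))"
          by (intro sums_mult exp_converges)
        then show "(\<lambda>k. r ^ k / fact k * exp (- r) * q ^ k) sums (exp (- r) * exp (r * q))"
          by (simp add: power_mult_distrib divide_inverse mult_ac)
      qed (use r q in simp)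
      also have "exp (- r) * exp (r * q) = exp (- measure m (- {..z}))"
      proof -
        have "measure m (- {..z}) = r - measure m {..z}"
          using m.finite_measure_compl[of "{..z}"] by (simp add: space sets r_def Compl_eq_Diff_UNIV)
        then show ?thesis using r by (simp add: q_def mult_exp_exp)
      qed
      finally show ?thesis by (simp add: P.emeasure_eq_measure)
    qed
    then show ?thesis using P setsP AE by blast
  qed
qed

text \<open>The exponent measure has finite mass outside \<open>{0..e}\<close>. Taken as the
  intensity of a compound Poisson maximum, this restriction produces the max-stable distribution
  function at every threshold above \<open>e\<close>.\<close>

lemma (in spherical_measure) stable_max_exists:
  assumes \<alpha>: "0 < \<alpha>" and \<epsilon>: "0 < \<epsilon>"
  shows "\<exists>P. prob_space P \<and> sets P = sets borel \<and> (AE w in P. \<forall>i. \<epsilon> \<le> w $ i) \<and>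
    (\<forall>z. (\<forall>i. \<epsilon> \<le> z $ i) \<longrightarrow> measure P {..z} = exp (- tail_integral \<alpha> \<rho> z))"
proof -
  define e :: "real^'d" where "e = (\<chi> i. \<epsilon>)"
  have e_le: "e \<le> z \<longleftrightarrow> (\<forall>i. \<epsilon> \<le> z $ i)" for z by (simp add: e_def vec_le_iff)
  let ?\<mu> = "exponent_measure \<alpha> \<rho>"
  let ?B = "E0 - {0..e}"
  define m where "m = distr (restrict_space ?\<mu> ?B) borel (\<lambda>x. x)"
  have B: "?B \<in> sets ?\<mu>" by (simp add: sets_exponent_measure box_complement_sets)
  have B': "?B \<inter> space ?\<mu> \<in> sets ?\<mu>" using B by (simp add: sets.Int_space_eq2)
  have meas: "(\<lambda>x. x) \<in> measurable (restrict_space ?\<mu> ?B) borel"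
    by (intro measurable_restrict_space1)
      (simp add: measurable_cong_sets[OF sets_exponent_measure refl] measurable_restrict_space1)
  have e_pos: "e \<in> pos_orthant" using \<epsilon> by (simp add: e_def pos_orthant_def)
  have em: "emeasure m (- {..z}) = ennreal (tail_integral \<alpha> \<rho> z)" if "e \<le> z" for z
  proof -
    have z: "z \<in> pos_orthant"
      using that \<epsilon> by (auto simp: e_le pos_orthant_def intro: less_le_trans)
    have "emeasure m (- {..z}) = emeasure (restrict_space ?\<mu> ?B) (- {..z} \<inter> space (restrict_space ?\<mu> ?B))"
      unfolding m_def by (subst emeasure_distr[OF meas]) (auto intro: borel_comp)
    \<comment> \<open>Since \<open>e \<le> z\<close>, a point of \<open>E0\<close> outside
      \<open>{0..z}\<close> is also outside \<open>{0..e}\<close>, so the restriction loses none of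
      this set.\<close>
    also have "- {..z} \<inter> space (restrict_space ?\<mu> ?B) = E0 - {0..z}"
      using that e_pos z sets.sets_into_space[OF B]
      by (auto simp: space_restrict_space exponent_measure_def E0_def intro: order_trans)
    also have "emeasure (restrict_space ?\<mu> ?B) (E0 - {0..z}) = emeasure ?\<mu> (E0 - {0..z})"
      using that by (intro emeasure_restrict_space B') (auto intro: order_trans)
    finally show ?thesis using \<alpha> z by (simp add: emeasure_exponent_measure)
  qed
  have fin: "finite_measure m"
  proof
    have "emeasure m (space m) = emeasure (restrict_space ?\<mu> ?B) (space (restrict_space ?\<mu> ?B))"
      unfolding m_def by (subst emeasure_distr[OF meas]) auto
    also have "\<dots> = emeasure ?\<mu> ?B"
      using sets.sets_into_space[OF B]
      by (subst emeasure_restrict_space[OF B']) (auto simp: space_restrict_space intro!: arg_cong[where f="emeasure ?\<mu>"])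
    finally show "emeasure m (space m) \<noteq> \<infinity>"
      using emeasure_exponent_measure[OF \<alpha> e_pos] by simp
  qed
  have "measure m (- {..z}) = tail_integral \<alpha> \<rho> z" if "e \<le> z" for z
    using em[OF that] by (simp add: measure_def tail_integral_nonneg)
  moreover have "sets m = sets borel" by (simp add: m_def)
  ultimately show ?thesis
    using compound_poisson_max[OF fin, of e] unfolding e_le by metis
qed

section \<open>Lipschitz functionals of coupled vectors\<close>

definition l1_lipschitz :: "(real^'d \<Rightarrow> real) \<Rightarrow> bool" where
  "l1_lipschitz h \<longleftrightarrow> (\<forall>x y. \<bar>h x - h y\<bar> \<le> l1_norm (x - y))"

lemma l1_lipschitz_measurable:
  fixes h :: "real^'d \<Rightarrow> real"
  assumes "l1_lipschitz h" shows "h \<in> borel_measurable borel"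
proof (intro borel_measurable_continuous_onI lipschitz_on_continuous_on lipschitz_onI)
  fix x y :: "real^'d"
  have "\<bar>h x - h y\<bar> \<le> l1_norm (x - y)" using assms by (simp add: l1_lipschitz_def)
  also have "\<dots> \<le> (\<Sum>j\<in>(UNIV :: 'd set). norm (x - y))"
    unfolding l1_norm_def by (intro sum_mono component_le_norm_cart)
  finally show "dist (h x) (h y) \<le> real CARD('d) * dist x y" by (simp add: dist_norm)
qed simp

lemma l1_lipschitz_integrable:
  assumes h: "l1_lipschitz h" and M: "finite_measure M" and X: "X \<in> borel_measurable M"
    and int: "\<And>j. integrable M (\<lambda>\<omega>. X \<omega> $ j)"
  shows "integrable M (\<lambda>\<omega>. h (X \<omega>))"
proof (rule Bochner_Integration.integrable_bound)
  show "integrable M (\<lambda>\<omega>. \<bar>h 0\<bar> + l1_norm (X \<omega>))"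
    unfolding l1_norm_def using int
    by (intro Bochner_Integration.integrable_add finite_measure.integrable_const[OF M]
      Bochner_Integration.integrable_sum integrable_abs)
  show "(\<lambda>\<omega>. h (X \<omega>)) \<in> borel_measurable M"
    using measurable_compose[OF X l1_lipschitz_measurable[OF h]] .
  show "AE \<omega> in M. norm (h (X \<omega>)) \<le> norm (\<bar>h 0\<bar> + l1_norm (X \<omega>))"
  proof (rule AE_I2)
    fix \<omega>
    have "\<bar>h (X \<omega>) - h 0\<bar> \<le> l1_norm (X \<omega> - 0)" using h unfolding l1_lipschitz_def by blast
    then show "norm (h (X \<omega>)) \<le> norm (\<bar>h 0\<bar> + l1_norm (X \<omega>))" by simp
  qed
qed

lemma l1_lipschitz_expectation_diff:
  fixes X :: "'a \<Rightarrow> real^'d"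
  assumes h: "l1_lipschitz h" and M: "finite_measure M"
    and X: "X \<in> borel_measurable M" "\<And>j. integrable M (\<lambda>\<omega>. X \<omega> $ j)"
    and Y: "Y \<in> borel_measurable M" "\<And>j. integrable M (\<lambda>\<omega>. Y \<omega> $ j)"
  shows "\<bar>(\<integral>\<omega>. h (X \<omega>) \<partial>M) - (\<integral>\<omega>. h (Y \<omega>) \<partial>M)\<bar> \<le> (\<Sum>j\<in>UNIV. \<integral>\<omega>. \<bar>X \<omega> $ j - Y \<omega> $ j\<bar> \<partial>M)"
proof -
  note hX = l1_lipschitz_integrable[OF h M X] and hY = l1_lipschitz_integrable[OF h M Y]
  have "\<bar>(\<integral>\<omega>. h (X \<omega>) \<partial>M) - (\<integral>\<omega>. h (Y \<omega>) \<partial>M)\<bar> = \<bar>\<integral>\<omega>. h (X \<omega>) - h (Y \<omega>) \<partial>M\<bar>"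
    using hX hY by simp
  also have "\<dots> \<le> (\<integral>\<omega>. \<bar>h (X \<omega>) - h (Y \<omega>)\<bar> \<partial>M)"
    by (rule integral_abs_bound)
  also have "\<dots> \<le> (\<integral>\<omega>. (\<Sum>j\<in>UNIV. \<bar>X \<omega> $ j - Y \<omega> $ j\<bar>) \<partial>M)"
    using h hX hY X(2) Y(2)
    by (intro integral_mono integrable_abs Bochner_Integration.integrable_sum
      Bochner_Integration.integrable_diff) (auto simp: l1_lipschitz_def l1_norm_def)
  also have "\<dots> = (\<Sum>j\<in>UNIV. \<integral>\<omega>. \<bar>X \<omega> $ j - Y \<omega> $ j\<bar> \<partial>M)"
    using X(2) Y(2) by (intro Bochner_Integration.integral_sum) auto
  finally show ?thesis .
qed

section \<open>Coupling\<close>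

lemma max_stable_vectorD:
  assumes "max_stable_vector M Z \<alpha> \<nu>"
  shows "prob_space M" "Z \<in> borel_measurable M" "\<omega> \<in> space M \<Longrightarrow> 0 < Z \<omega> $ j"
    "\<omega> \<in> space M \<Longrightarrow> 0 \<le> Z \<omega>"
proof -
  have Z: "Z \<in> measurable M (restrict_space borel pos_orthant)"
    using assms by (simp add: max_stable_vector_def)
  show "prob_space M" using assms by (simp add: max_stable_vector_def)
  show "Z \<in> borel_measurable M" using Z by (simp add: measurable_restrict_space2_iff)
  have pos: "Z \<omega> \<in> pos_orthant" if "\<omega> \<in> space M" for \<omega>
    using measurable_space[OF Z that] by (simp add: space_restrict_space)
  show "\<omega> \<in> space M \<Longrightarrow> 0 < Z \<omega> $ j" using pos by (simp add: pos_orthant_def)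
  show "\<omega> \<in> space M \<Longrightarrow> 0 \<le> Z \<omega>" using pos by (auto simp: pos_orthant_def vec_le_iff less_imp_le)
qed

lemma (in spherical_measure) max_stable_vector_cdf:
  assumes "max_stable_vector M Z \<alpha> \<rho>" "0 < \<alpha>" "z \<in> pos_orthant"
  shows "measure (distr M borel Z) {..z} = exp (- tail_integral \<alpha> \<rho> z)"
    "measure M {\<omega>\<in>space M. Z \<omega> \<le> z} = exp (- tail_integral \<alpha> \<rho> z)"
proof -
  show "measure M {\<omega>\<in>space M. Z \<omega> \<le> z} = exp (- tail_integral \<alpha> \<rho> z)"
    using assms by (simp add: max_stable_vector_def measure_exponent_measure)
  then show "measure (distr M borel Z) {..z} = exp (- tail_integral \<alpha> \<rho> z)"
    by (simp add: measure_distr max_stable_vectorD(2)[OF assms(1)] vimage_def Int_def conj_commute)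
qed

lemma (in spherical_measure) frechet_variable_nth:
  assumes Z: "max_stable_vector M Z \<alpha> \<rho>" and \<alpha>: "0 < \<alpha>" and one: "(\<integral>u. u $ j \<partial>\<rho>) = 1"
  shows "frechet_variable M (\<lambda>\<omega>. Z \<omega> $ j) \<alpha>"
proof -
  interpret M: prob_space M using Z by (rule max_stable_vectorD)
  have [measurable]: "Z \<in> borel_measurable M" using Z by (rule max_stable_vectorD)
  have "measure M {\<omega>\<in>space M. Z \<omega> $ j \<le> x} = exp (- (x powr - \<alpha>))" if "0 < x" for x
  proof -
    have "measure M {\<omega>\<in>space M. Z \<omega> $ j \<le> x} = measure (distr M borel Z) {w. w $ j \<le> x}"
      by (subst measure_distr) (auto intro!: arg_cong[where f="measure M"])
    also have "\<dots> = exp (- ((\<integral>u. u $ j \<partial>\<rho>) * x powr - \<alpha>))"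
      using that by (intro marginal_cdf[where \<epsilon>=0] M.prob_space_distr max_stable_vector_cdf Z \<alpha>) auto
    finally show ?thesis by (simp add: one)
  qed
  then show ?thesis by (simp add: frechet_variable_def M.prob_space_axioms)
qed

text \<open>\<open>P\<close> is the truncated max-stable law of the smaller measure
  \<open>\<kappa>\<close>. An independent truncated law for the remainder \<open>\<rho>\<close>
  restores the full vector, because maxima of independent vectors add tail integrals. A maximum
  dominates its first argument, so the mean distance per coordinate is a difference of means, which
  the marginals make explicit.\<close>

lemma wasserstein_minorant:
  fixes \<kappa> \<rho> \<nu> :: "(real^'d) measure"
  assumes sp: "spherical_measure \<nu> S" "spherical_measure \<kappa> S" "spherical_measure \<rho> S"
    and tail: "\<And>z. tail_integral \<alpha> \<nu> z = tail_integral \<alpha> \<kappa> z + tail_integral \<alpha> \<rho> z"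
    and mean: "\<And>j. (\<integral>u. u $ j \<partial>\<nu>) = 1" "\<And>j. (\<integral>u. u $ j \<partial>\<kappa>) + (\<integral>u. u $ j \<partial>\<rho>) = 1"
    and \<alpha>: "1 < \<alpha>" and \<epsilon>: "0 < \<epsilon>" and Z: "max_stable_vector M Z \<alpha> \<nu>"
    and P: "prob_space P" "sets P = sets borel" "AE w in P. \<forall>i. \<epsilon> \<le> w $ i"
      "\<And>z. (\<And>i. \<epsilon> \<le> z $ i) \<Longrightarrow> measure P {..z} = exp (- tail_integral \<alpha> \<kappa> z)"
    and h: "l1_lipschitz h"
  shows "\<bar>(\<integral>\<omega>. h (Z \<omega>) \<partial>M) - (\<integral>w. h w \<partial>P)\<bar> \<le>
    real CARD('d) * \<epsilon> + real CARD('d) * Gamma (1 - 1 / \<alpha>) * measure \<rho> (space \<rho>)"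
proof -
  interpret \<nu>: spherical_measure \<nu> S by fact
  interpret L: spherical_measure \<kappa> S by fact
  interpret R: spherical_measure \<rho> S by fact
  interpret M: prob_space M using Z by (rule max_stable_vectorD)
  interpret P: prob_space P by fact
  have \<alpha>0: "0 < \<alpha>" using \<alpha> by simp
  have [measurable]: "Z \<in> borel_measurable M" using Z by (rule max_stable_vectorD)
  note [measurable_cong] = P(2)
  have [measurable]: "h \<in> borel_measurable borel" by (rule l1_lipschitz_measurable[OF h])
  define e :: "real^'d" where "e = (\<chi> i. \<epsilon>)"
  have e_le: "e \<le> z \<longleftrightarrow> (\<forall>i. \<epsilon> \<le> z $ i)" for z by (simp add: e_def vec_le_iff)
  have e_pos: "z \<in> pos_orthant" if "e \<le> z" for z
    using that \<epsilon> by (auto simp: e_le pos_orthant_def intro: less_le_trans)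
  obtain Q where Q: "prob_space Q" "sets Q = sets borel" "AE w in Q. \<forall>i. \<epsilon> \<le> w $ i"
    "\<And>z. (\<And>i. \<epsilon> \<le> z $ i) \<Longrightarrow> measure Q {..z} = exp (- tail_integral \<alpha> \<rho> z)"
    using R.stable_max_exists[OF \<alpha>0 \<epsilon>] by blast
  interpret Q: prob_space Q by fact
  note [measurable_cong] = Q(2)
  interpret PQ: pair_prob_space P Q ..
  let ?PQ = "P \<Otimes>\<^sub>M Q"
  let ?V = "\<lambda>x. vmax (fst x) (snd x)"
  \<comment> \<open>Both distribution functions are
    \<open>exp (- tail_integral \<alpha> \<nu> z)\<close> for \<open>e \<le> z\<close> and 0
    otherwise.\<close>
  have law: "distr M borel (\<lambda>\<omega>. vmax (Z \<omega>) e) = distr ?PQ borel ?V" (is "?L1 = ?L2")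
  proof (rule measure_eqI_atMost)
    show "finite_measure ?L1" by (rule M.finite_measure_distr) simp
    fix z
    have "emeasure ?L1 {..z} = emeasure M {\<omega>\<in>space M. Z \<omega> \<le> z \<and> e \<le> z}"
      by (subst emeasure_distr) (auto simp: vmax_le_iff intro!: arg_cong[where f="emeasure M"])
    moreover have "emeasure ?L2 {..z} = emeasure P {..z} * emeasure Q {..z}"
    proof -
      have "emeasure ?L2 {..z} = emeasure ?PQ ({..z} \<times> {..z})"
        by (simp add: emeasure_distr) (auto intro!: arg_cong[where f="emeasure _"]
          simp: space_pair_measure vmax_le_iff sets_eq_imp_space_eq[OF P(2)] sets_eq_imp_space_eq[OF Q(2)])
      also have "\<dots> = emeasure P {..z} * emeasure Q {..z}"
        by (rule Q.emeasure_pair_measure_Times) (auto simp: P(2) Q(2))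
      finally show ?thesis .
    qed
    moreover have "emeasure M {\<omega>\<in>space M. Z \<omega> \<le> z \<and> e \<le> z} = emeasure P {..z} * emeasure Q {..z}"
    proof (cases "e \<le> z")
      case True
      then show ?thesis
        using P(4)[of z] Q(4)[of z] \<nu>.max_stable_vector_cdf(2)[OF Z \<alpha>0 e_pos[OF True]] tail[of z]
        by (simp add: e_le M.emeasure_eq_measure P.emeasure_eq_measure Q.emeasure_eq_measure
          mult_exp_exp flip: ennreal_mult)
    next
      case False
      have "AE w in P. \<not> w \<le> z"
        using P(3) by eventually_elim (use False in \<open>auto simp flip: e_le intro: order_trans\<close>)
      then have "emeasure P {w\<in>space P. w \<le> z} = 0" by (rule emeasure_eq_0_AE)
      then have "emeasure P {..z} = 0" by (simp add: sets_eq_imp_space_eq[OF P(2)] atMost_def)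
      then show ?thesis using False by simp
    qed
    ultimately show "emeasure ?L1 {..z} = emeasure ?L2 {..z}" by simp
  qed simp_all
  have transfer: "(\<integral>\<omega>. f (vmax (Z \<omega>) e) \<partial>M) = (\<integral>x. f (?V x) \<partial>?PQ)"
    "integrable M (\<lambda>\<omega>. f (vmax (Z \<omega>) e)) \<longleftrightarrow> integrable ?PQ (\<lambda>x. f (?V x))"
    if [measurable]: "f \<in> borel_measurable borel" for f :: "real^'d \<Rightarrow> real"
    using arg_cong[OF law, of "\<lambda>L. integral\<^sup>L L f"] arg_cong[OF law, of "\<lambda>L. integrable L f"]
    by (simp_all add: integral_distr integrable_distr_eq)
  have fst_distr: "distr ?PQ P fst = P" by (rule Q.distr_pair_fst)
  have transfer_fst: "(\<integral>x. f (fst x) \<partial>?PQ) = (\<integral>w. f w \<partial>P)"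
    "integrable ?PQ (\<lambda>x. f (fst x)) \<longleftrightarrow> integrable P f"
    if [measurable]: "f \<in> borel_measurable borel" for f :: "real^'d \<Rightarrow> real"
    using arg_cong[OF fst_distr, of "\<lambda>L. integral\<^sup>L L f"] arg_cong[OF fst_distr, of "\<lambda>L. integrable L f"]
    by (simp_all add: integral_distr integrable_distr_eq)

  have frechet: "frechet_variable M (\<lambda>\<omega>. Z \<omega> $ j) \<alpha>" for j
    by (rule \<nu>.frechet_variable_nth[OF Z \<alpha>0 mean(1)])
  have Z_int: "integrable M (\<lambda>\<omega>. Z \<omega> $ j)" and Z_mean: "(\<integral>\<omega>. Z \<omega> $ j \<partial>M) = Gamma (1 - 1 / \<alpha>)" for j
    using frechet_variable_expectation[OF frechet \<alpha>] by auto
  define c where "c j = (\<integral>u. u $ j \<partial>\<kappa>)" for j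
  \<comment> \<open>The scaling for which \<open>k j * Z \<omega> $ j\<close> has distribution
    function \<open>exp (- (c j * x powr - \<alpha>))\<close> at positive \<open>x\<close>.\<close>
  define k where "k j = c j powr (1 / \<alpha>)" for j
  have c: "0 \<le> c j" "c j \<le> 1" and cR: "1 - c j \<le> measure \<rho> (space \<rho>)" for j
  proof -
    show "0 \<le> c j" unfolding c_def by (intro integral_nonneg_AE AE_I2 L.space_D(3))
    have "0 \<le> (\<integral>u. u $ j \<partial>\<rho>)" by (intro integral_nonneg_AE AE_I2 R.space_D(3))
    then show "c j \<le> 1" using mean(2)[of j] by (simp add: c_def)
    have "(\<integral>u. u $ j \<partial>\<rho>) \<le> (\<integral>u. 1 \<partial>\<rho>)"
      by (intro integral_mono R.integrable_nth R.integrable_const R.space_D(4))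
    then show "1 - c j \<le> measure \<rho> (space \<rho>)" using mean(2)[of j] by (simp add: c_def)
  qed
  have k: "c j \<le> k j" "k j \<le> 1" "0 \<le> k j" for j
  proof -
    \<comment> \<open>On the unit interval a smaller exponent gives a larger power, and
      \<open>1 / \<alpha> < 1\<close>.\<close>
    have "c j powr 1 \<le> c j powr (1 / \<alpha>)"
      using c[of j] \<alpha> by (intro powr_mono') auto
    then show "c j \<le> k j" using c[of j] by (simp add: k_def)
    show "k j \<le> 1" unfolding k_def using c[of j] \<alpha> by (intro powr_le1) auto
  qed (simp add: k_def)
  \<comment> \<open>Only single coordinates are matched here, which is enough to compute their
    means.\<close>
  have marg: "distr P borel (\<lambda>w. w $ j) = distr M borel (\<lambda>\<omega>. max (k j * Z \<omega> $ j) \<epsilon>)" for j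
  proof (rule measure_eqI_atMost)
    show "finite_measure (distr P borel (\<lambda>w. w $ j))" by (rule P.finite_measure_distr) simp
    fix x :: real
    show "emeasure (distr P borel (\<lambda>w. w $ j)) {..x} =
        emeasure (distr M borel (\<lambda>\<omega>. max (k j * Z \<omega> $ j) \<epsilon>)) {..x}"
    proof (cases "\<epsilon> \<le> x")
      case True
      then have x: "0 < x" using \<epsilon> by simp
      have "emeasure (distr P borel (\<lambda>w. w $ j)) {..x} = emeasure P {w. w $ j \<le> x}"
        by (subst emeasure_distr) (auto simp: sets_eq_imp_space_eq[OF P(2)] vimage_def)
      also have "\<dots> = ennreal (exp (- (c j * x powr - \<alpha>)))"
        unfolding P.emeasure_eq_measure c_def
        using L.marginal_cdf[OF P(1,2) \<alpha>0 P(4) x True, of j] by simp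
      also have "\<dots> = emeasure M {\<omega>\<in>space M. k j * Z \<omega> $ j \<le> x}"
      \<comment> \<open>If \<open>c j = 0\<close> then also \<open>k j = 0\<close>, because
        \<open>0 powr (1 / \<alpha>) = 0\<close>, and both probabilities are 1.\<close>
      proof (cases "c j = 0")
        case True
        then show ?thesis using x by (simp add: k_def M.emeasure_space_1)
      next
        case False
        then have "0 < k j" by (simp add: k_def)
        then have "emeasure M {\<omega>\<in>space M. k j * Z \<omega> $ j \<le> x} = emeasure M {\<omega>\<in>space M. Z \<omega> $ j \<le> x / k j}"
          by (simp add: field_simps)
        also have "\<dots> = ennreal (exp (- ((x / k j) powr - \<alpha>)))"
          using frechet[of j] x \<open>0 < k j\<close> by (simp add: frechet_variable_def M.emeasure_eq_measure)
        also have "(x / k j) powr - \<alpha> = c j * x powr - \<alpha>"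
          using x False c[of j] \<alpha> by (simp add: k_def powr_divide powr_powr powr_minus field_simps)
        finally show ?thesis by simp
      qed
      also have "\<dots> = emeasure (distr M borel (\<lambda>\<omega>. max (k j * Z \<omega> $ j) \<epsilon>)) {..x}"
        using True by (subst emeasure_distr) (auto intro!: arg_cong[where f="emeasure M"])
      finally show ?thesis .
    next
      case False
      have "AE w in P. \<not> w $ j \<le> x"
        using P(3) by eventually_elim (use False in \<open>auto simp: not_le intro: less_le_trans\<close>)
      then have "emeasure P {w\<in>space P. w $ j \<le> x} = 0" by (rule emeasure_eq_0_AE)
      then have "emeasure (distr P borel (\<lambda>w. w $ j)) {..x} = 0"
        by (subst emeasure_distr) (auto simp: sets_eq_imp_space_eq[OF P(2)] vimage_def)
      moreover have "(\<lambda>\<omega>. max (k j * Z \<omega> $ j) \<epsilon>) -` {..x} \<inter> space M = {}" using False by auto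
      then have "emeasure (distr M borel (\<lambda>\<omega>. max (k j * Z \<omega> $ j) \<epsilon>)) {..x} = 0"
        by (subst emeasure_distr) auto
      ultimately show ?thesis by simp
    qed
  qed simp_all
  have kZ_int: "integrable M (\<lambda>\<omega>. max (k j * Z \<omega> $ j) \<epsilon>)" for j
    by (intro integrable_max integrable_mult_right Z_int M.integrable_const)
  have P_int: "integrable P (\<lambda>w. w $ j)"
    and P_mean: "(\<integral>w. w $ j \<partial>P) = (\<integral>\<omega>. max (k j * Z \<omega> $ j) \<epsilon> \<partial>M)" for j
    using kZ_int[of j] arg_cong[OF marg[of j], of "\<lambda>L. integral\<^sup>L L (\<lambda>x. x)"]
      arg_cong[OF marg[of j], of "\<lambda>L. integrable L (\<lambda>x. x)"]
    by (simp_all add: integral_distr integrable_distr_eq)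
  have Ze_int: "integrable M (\<lambda>\<omega>. vmax (Z \<omega>) e $ j)" for j
    unfolding vmax_nth e_def vec_lambda_beta by (intro integrable_max Z_int M.integrable_const)
  have V_int: "integrable ?PQ (\<lambda>x. ?V x $ j)" for j
    using Ze_int[of j] transfer(2)[of "\<lambda>x. x $ j"] by simp
  have W_int: "integrable ?PQ (\<lambda>x. fst x $ j)" for j
    using P_int[of j] transfer_fst(2)[of "\<lambda>x. x $ j"] by simp

  \<comment> \<open>Raising the coordinates to level \<open>\<epsilon>\<close> moves each of them by
    at most \<open>\<epsilon>\<close>, as they are positive.\<close>
  have "\<bar>(\<integral>\<omega>. h (Z \<omega>) \<partial>M) - (\<integral>\<omega>. h (vmax (Z \<omega>) e) \<partial>M)\<bar> \<le>
      (\<Sum>j\<in>UNIV. \<integral>\<omega>. \<bar>Z \<omega> $ j - vmax (Z \<omega>) e $ j\<bar> \<partial>M)"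
    by (intro l1_lipschitz_expectation_diff h M.finite_measure_axioms Z_int Ze_int) measurable
  also have "\<dots> \<le> (\<Sum>j\<in>(UNIV :: 'd set). \<integral>\<omega>. \<epsilon> \<partial>M)"
  proof (intro sum_mono integral_mono integrable_abs Bochner_Integration.integrable_diff Z_int Ze_int
      M.integrable_const)
    fix j \<omega> assume "\<omega> \<in> space M"
    then show "\<bar>Z \<omega> $ j - vmax (Z \<omega>) e $ j\<bar> \<le> \<epsilon>"
      using max_stable_vectorD(3)[OF Z, of \<omega> j] \<epsilon> by (auto simp: e_def max_def)
  qed
  finally have 1: "\<bar>(\<integral>\<omega>. h (Z \<omega>) \<partial>M) - (\<integral>\<omega>. h (vmax (Z \<omega>) e) \<partial>M)\<bar> \<le> real CARD('d) * \<epsilon>"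
    by (simp add: M.prob_space)

  have "\<bar>(\<integral>x. h (?V x) \<partial>?PQ) - (\<integral>x. h (fst x) \<partial>?PQ)\<bar> \<le>
      (\<Sum>j\<in>UNIV. \<integral>x. \<bar>?V x $ j - fst x $ j\<bar> \<partial>?PQ)"
    by (intro l1_lipschitz_expectation_diff h PQ.finite_measure_axioms V_int W_int) measurable
  \<comment> \<open>The maximum dominates its first argument, so the absolute values drop and only
    means remain.\<close>
  also have "\<dots> = (\<Sum>j\<in>UNIV. \<integral>x. ?V x $ j - fst x $ j \<partial>?PQ)"
    by (intro sum.cong Bochner_Integration.integral_cong) auto
  also have "\<dots> = (\<Sum>j\<in>UNIV. (\<integral>\<omega>. vmax (Z \<omega>) e $ j \<partial>M) - (\<integral>\<omega>. max (k j * Z \<omega> $ j) \<epsilon> \<partial>M))"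
    using V_int W_int transfer(1)[of "\<lambda>x. x $ _"] transfer_fst(1)[of "\<lambda>x. x $ _"]
    by (simp del: vmax_nth add: P_mean)
  also have "\<dots> \<le> (\<Sum>j\<in>(UNIV :: 'd set). Gamma (1 - 1 / \<alpha>) * measure \<rho> (space \<rho>))"
  proof (rule sum_mono)
    fix j :: 'd
    have "(\<integral>\<omega>. vmax (Z \<omega>) e $ j \<partial>M) - (\<integral>\<omega>. max (k j * Z \<omega> $ j) \<epsilon> \<partial>M) =
        (\<integral>\<omega>. vmax (Z \<omega>) e $ j - max (k j * Z \<omega> $ j) \<epsilon> \<partial>M)"
      using Ze_int kZ_int by simp
    \<comment> \<open>Taking the maximum with \<open>\<epsilon>\<close> does not increase distances,
      and \<open>k j * Z \<omega> $ j \<le> Z \<omega> $ j\<close>.\<close>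
    also have "\<dots> \<le> (\<integral>\<omega>. (1 - k j) * Z \<omega> $ j \<partial>M)"
    proof (intro integral_mono Bochner_Integration.integrable_diff Ze_int kZ_int integrable_mult_right Z_int)
      fix \<omega> assume "\<omega> \<in> space M"
      then have "0 < Z \<omega> $ j" using max_stable_vectorD(3)[OF Z, of \<omega> j] by simp
      then have "k j * Z \<omega> $ j \<le> Z \<omega> $ j" using k[of j] by (simp add: mult_left_le_one_le)
      then show "vmax (Z \<omega>) e $ j - max (k j * Z \<omega> $ j) \<epsilon> \<le> (1 - k j) * Z \<omega> $ j"
        using \<epsilon> by (auto simp: e_def max_def algebra_simps)
    qed
    also have "\<dots> = (1 - k j) * Gamma (1 - 1 / \<alpha>)" by (simp add: Z_mean)
    also have "\<dots> \<le> measure \<rho> (space \<rho>) * Gamma (1 - 1 / \<alpha>)"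
    proof (rule mult_right_mono)
      \<comment> \<open>Here \<open>c j \<le> k j\<close>, and \<open>1 - c j\<close> is the first
        moment of \<open>\<rho>\<close>, at most its mass since
        \<open>u $ j \<le> 1\<close>.\<close>
      show "1 - k j \<le> measure \<rho> (space \<rho>)" using k(1)[of j] cR[of j] by linarith
      show "0 \<le> Gamma (1 - 1 / \<alpha>)" using \<alpha> by (intro less_imp_le Gamma_real_pos) auto
    qed
    finally show "(\<integral>\<omega>. vmax (Z \<omega>) e $ j \<partial>M) - (\<integral>\<omega>. max (k j * Z \<omega> $ j) \<epsilon> \<partial>M) \<le>
        Gamma (1 - 1 / \<alpha>) * measure \<rho> (space \<rho>)" by (simp add: mult.commute)
  qed
  finally have "\<bar>(\<integral>\<omega>. h (vmax (Z \<omega>) e) \<partial>M) - (\<integral>w. h w \<partial>P)\<bar> \<le>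
      real CARD('d) * Gamma (1 - 1 / \<alpha>) * measure \<rho> (space \<rho>)"
    by (simp add: transfer(1) transfer_fst(1) mult.assoc)
  with 1 show ?thesis by linarith
qed

section \<open>Kolmogorov distance\<close>

lemma max_weight_vpowr:
  assumes "0 < \<alpha>"
  shows "max_weight \<alpha> (vpowr z (\<alpha>' / \<alpha>)) u = max_weight \<alpha>' z u"
  using assms by (simp add: max_weight_def vpowr_def powr_powr)

text \<open>The power moves the threshold from \<open>z\<close> to
  \<open>vpowr z (\<alpha>' / \<alpha>)\<close>, and \<open>max_weight\<close> absorbs this into a
  change of index; the angular measure stays the same.\<close>

lemma (in spherical_measure) max_stable_vector_vpowr:
  assumes Z: "max_stable_vector M Z \<alpha> \<rho>" and \<alpha>: "0 < \<alpha>" "0 < \<alpha>'"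
  shows "max_stable_vector M (\<lambda>\<omega>. vpowr (Z \<omega>) (\<alpha> / \<alpha>')) \<alpha>' \<rho>"
proof -
  interpret M: prob_space M using Z by (rule max_stable_vectorD)
  have [measurable]: "Z \<in> borel_measurable M" using Z by (rule max_stable_vectorD)
  have meas: "(\<lambda>\<omega>. vpowr (Z \<omega>) (\<alpha> / \<alpha>')) \<in> borel_measurable M"
    by (rule measurable_compose[OF _ borel_measurable_vpowr]) measurable
  have pos: "vpowr (Z \<omega>) (\<alpha> / \<alpha>') \<in> pos_orthant" if "\<omega> \<in> space M" for \<omega>
    unfolding pos_orthant_def vpowr_def
    using max_stable_vectorD(3)[OF Z that] by (auto simp: less_imp_neq[symmetric])
  have "measure M {\<omega>\<in>space M. vpowr (Z \<omega>) (\<alpha> / \<alpha>') \<le> z} =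
      exp (- measure (exponent_measure \<alpha>' \<rho>) (E0 - {0..z}))" if z: "z \<in> pos_orthant" for z
  proof -
    have z': "vpowr z (\<alpha>' / \<alpha>) \<in> pos_orthant"
      using z by (simp add: pos_orthant_def vpowr_def) (metis less_irrefl)
    have "x powr (\<alpha> / \<alpha>') \<le> y \<longleftrightarrow> x \<le> y powr (\<alpha>' / \<alpha>)" if "0 < x" "0 < y" for x y :: real
      using that \<alpha> by (subst (1 2) ln_le_cancel_iff[symmetric]) (auto simp: ln_powr field_simps)
    then have "{\<omega>\<in>space M. vpowr (Z \<omega>) (\<alpha> / \<alpha>') \<le> z} = {\<omega>\<in>space M. Z \<omega> \<le> vpowr z (\<alpha>' / \<alpha>)}"
      using z max_stable_vectorD(3)[OF Z] by (auto simp: vec_le_iff vpowr_def pos_orthant_def)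
    then show ?thesis
      using max_stable_vector_cdf(2)[OF Z \<alpha>(1) z'] \<alpha> z
      by (simp add: measure_exponent_measure tail_integral_def max_weight_vpowr)
  qed
  then show ?thesis
    using meas pos by (simp add: max_stable_vector_def M.prob_space_axioms measurable_restrict_space2)
qed

section \<open>Dependence on the angular measure\<close>

lemma (in spherical_measure) tail_integral_ge:
  "(\<integral>u. u $ j \<partial>\<rho>) * (z $ j) powr - \<alpha> \<le> tail_integral \<alpha> \<rho> z"
proof -
  have "(\<integral>u. u $ j * (z $ j) powr - \<alpha> \<partial>\<rho>) \<le> tail_integral \<alpha> \<rho> z"
    unfolding tail_integral_def
    by (intro integral_mono integrable_max_weight integrable_mult_left integrable_nth max_weight_ge)
  then show ?thesis by simp
qed

text \<open>The all-ones vector dominates every \<open>u\<close> in the unit cube, so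
  \<open>max_weight \<alpha> z 1\<close>, the largest of the \<open>(z $ j) powr - \<alpha>\<close>,
  bounds the integrand.\<close>

lemma (in spherical_measure) tail_integral_le:
  "tail_integral \<alpha> \<rho> z \<le> max_weight \<alpha> z 1 * measure \<rho> (space \<rho>)"
proof -
  have "tail_integral \<alpha> \<rho> z \<le> (\<integral>u. max_weight \<alpha> z 1 \<partial>\<rho>)"
    unfolding tail_integral_def
  proof (intro integral_mono integrable_max_weight integrable_const max_weight_le)
    fix u j assume u: "u \<in> space \<rho>"
    have "u $ j * (z $ j) powr - \<alpha> \<le> (1 :: real^'d) $ j * (z $ j) powr - \<alpha>"
      using space_D[OF u] by (intro mult_right_mono) auto
    also have "\<dots> \<le> max_weight \<alpha> z 1" by (rule max_weight_ge)
    finally show "u $ j * (z $ j) powr - \<alpha> \<le> max_weight \<alpha> z 1" .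
  qed
  then show ?thesis by (simp add: mult.commute)
qed

text \<open>Radon-Nikodym derivatives between these finite measures are finite almost everywhere, so
  \<open>enn2real\<close> preserves the density. The alternative for \<open>K\<close> treats both
  summands at once.\<close>

lemma density_RN_deriv_add_measure:
  assumes fin: "finite_measure M" "finite_measure N" and sets: "sets N = sets M"
    and K: "K = M \<or> K = N"
  defines "f \<equiv> \<lambda>x. enn2real (RN_deriv (add_measure M N) K x)"
  shows "density (add_measure M N) (\<lambda>x. ennreal (f x)) = K"
proof -
  let ?A = "add_measure M N"
  have "finite_measure ?A"
    by (rule finite_measureI) (simp add: emeasure_add_measure[OF sets] sets
      finite_measure.emeasure_finite[OF fin(1)] finite_measure.emeasure_finite[OF fin(2)])
  then interpret A: finite_measure ?A .
  have setsK: "sets K = sets ?A" using K sets by auto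
  have ac: "absolutely_continuous ?A K"
    unfolding absolutely_continuous_def null_sets_def
    using K sets by (auto simp: emeasure_add_measure)
  have "sigma_finite_measure K" using K fin finite_measure.axioms(1) by auto
  then have "AE x in ?A. RN_deriv ?A K x \<noteq> \<infinity>"
    by (rule A.RN_deriv_finite[OF _ ac setsK])
  then have "AE x in ?A. ennreal (f x) = RN_deriv ?A K x"
    by eventually_elim (simp add: f_def less_top)
  then have "density ?A (\<lambda>x. ennreal (f x)) = density ?A (RN_deriv ?A K)"
    by (intro density_cong) (auto simp: f_def)
  also have "\<dots> = K" by (rule A.density_RN_deriv[OF ac setsK])
  finally show ?thesis .
qed

text \<open>With densities \<open>f1\<close>, \<open>f2\<close> relative to the sum, the common part
  has density \<open>g = min f1 f2\<close> and the remainders \<open>f1 - g\<close> and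
  \<open>f2 - g\<close>. At each point one remainder vanishes, so
  \<open>\<bar>f2 - f1\<bar> = (f1 - g) + (f2 - g)\<close>. The splitting is recorded through tail
  integrals and first moments, the two linear functionals that enter the couplings.\<close>

lemma spherical_common_part:
  assumes sp: "spherical_measure \<nu>\<^sub>1 S" "spherical_measure \<nu>\<^sub>2 S"
  obtains \<kappa> \<rho>\<^sub>1 \<rho>\<^sub>2 where "spherical_measure \<kappa> S" "spherical_measure \<rho>\<^sub>1 S" "spherical_measure \<rho>\<^sub>2 S"
    "\<And>\<alpha> z. tail_integral \<alpha> \<nu>\<^sub>1 z = tail_integral \<alpha> \<kappa> z + tail_integral \<alpha> \<rho>\<^sub>1 z"
    "\<And>\<alpha> z. tail_integral \<alpha> \<nu>\<^sub>2 z = tail_integral \<alpha> \<kappa> z + tail_integral \<alpha> \<rho>\<^sub>2 z"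
    "\<And>j. (\<integral>u. u $ j \<partial>\<nu>\<^sub>1) = (\<integral>u. u $ j \<partial>\<kappa>) + (\<integral>u. u $ j \<partial>\<rho>\<^sub>1)"
    "\<And>j. (\<integral>u. u $ j \<partial>\<nu>\<^sub>2) = (\<integral>u. u $ j \<partial>\<kappa>) + (\<integral>u. u $ j \<partial>\<rho>\<^sub>2)"
    "tv_dist \<nu>\<^sub>1 \<nu>\<^sub>2 = ennreal (measure \<rho>\<^sub>1 (space \<rho>\<^sub>1) + measure \<rho>\<^sub>2 (space \<rho>\<^sub>2))"
proof -
  interpret A: spherical_measure \<nu>\<^sub>1 S by fact
  interpret B: spherical_measure \<nu>\<^sub>2 S by fact
  define \<nu> where "\<nu> = add_measure \<nu>\<^sub>1 \<nu>\<^sub>2"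
  have sets12: "sets \<nu>\<^sub>2 = sets \<nu>\<^sub>1" by (simp add: A.sets_eq B.sets_eq)
  define f1 where "f1 x = enn2real (RN_deriv \<nu> \<nu>\<^sub>1 x)" for x
  define f2 where "f2 x = enn2real (RN_deriv \<nu> \<nu>\<^sub>2 x)" for x
  define g where "g x = min (f1 x) (f2 x)" for x
  have [measurable]: "f1 \<in> borel_measurable \<nu>" "f2 \<in> borel_measurable \<nu>"
    by (simp_all add: f1_def[abs_def] f2_def[abs_def])
  then have [measurable]: "g \<in> borel_measurable \<nu>" by (simp add: g_def[abs_def])
  have f_nonneg: "0 \<le> f1 x" "0 \<le> f2 x" for x by (simp_all add: f1_def f2_def)
  have g: "0 \<le> g x" "g x \<le> f1 x" "g x \<le> f2 x" for x using f_nonneg[of x] by (auto simp: g_def)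
  have d1: "density \<nu> f1 = \<nu>\<^sub>1" and d2: "density \<nu> f2 = \<nu>\<^sub>2"
    using density_RN_deriv_add_measure[OF A.finite_measure_axioms B.finite_measure_axioms sets12]
    unfolding \<nu>_def f1_def f2_def by auto
  \<comment> \<open>A smaller density gives again a finite measure on the same space, so the locale
    passes from \<open>\<nu>\<^sub>1\<close> and \<open>\<nu>\<^sub>2\<close> to their
    parts.\<close>
  have sub: "spherical_measure (density \<nu> f) S"
    if "spherical_measure (density \<nu> f') S" "\<And>x. f x \<le> f' x"
      and [measurable]: "f \<in> borel_measurable \<nu>" "f' \<in> borel_measurable \<nu>" for f f' :: "_ \<Rightarrow> real"
  proof -
    interpret F: spherical_measure "density \<nu> f'" S by fact
    have "finite_measure (density \<nu> f)"
    proof (rule finite_measureI)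
      have "emeasure (density \<nu> f) (space \<nu>) \<le> emeasure (density \<nu> f') (space \<nu>)"
        using that(2) by (auto simp: emeasure_density intro!: nn_integral_mono mult_right_mono ennreal_leI)
      then show "emeasure (density \<nu> f) (space (density \<nu> f)) \<noteq> \<infinity>"
        using neq_top_trans[OF F.emeasure_finite[unfolded infinity_ennreal_def]] by simp
    qed
    then show ?thesis
      using F.sets_eq F.S_subset by (simp add: spherical_measure_def spherical_measure_axioms_def)
  qed
  have add: "(\<integral>u. \<phi> u \<partial>density \<nu> f) = (\<integral>u. \<phi> u \<partial>density \<nu> g) + (\<integral>u. \<phi> u \<partial>density \<nu> (\<lambda>x. f x - g x))"
    if [measurable]: "f \<in> borel_measurable \<nu>" "\<phi> \<in> borel_measurable \<nu>" and "\<And>x. g x \<le> f x"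
      and "integrable (density \<nu> g) \<phi>" "integrable (density \<nu> (\<lambda>x. f x - g x)) \<phi>" for f \<phi> :: "_ \<Rightarrow> real"
  proof -
    have "0 \<le> f x" for x using g(1)[of x] that(3)[of x] by linarith
    then show ?thesis
      using that(3-5) g
      by (simp add: integral_density integrable_density algebra_simps flip: Bochner_Integration.integral_add)
  qed
  have spg: "spherical_measure (density \<nu> g) S"
    by (rule sub[of f1]) (use g sp d1 in auto)
  have spr: "spherical_measure (density \<nu> (\<lambda>x. f1 x - g x)) S" "spherical_measure (density \<nu> (\<lambda>x. f2 x - g x)) S"
    by (rule sub[of f1], use g sp d1 in auto) (rule sub[of f2], use g sp d2 in auto)
  interpret G: spherical_measure "density \<nu> g" S by fact
  interpret R1: spherical_measure "density \<nu> (\<lambda>x. f1 x - g x)" S by fact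
  interpret R2: spherical_measure "density \<nu> (\<lambda>x. f2 x - g x)" S by fact
  have meas: "\<phi> \<in> borel_measurable \<nu>" if "\<phi> \<in> borel_measurable borel" for \<phi> :: "real^'a \<Rightarrow> real"
    using A.measurable_borel[OF that] by (simp add: \<nu>_def cong: measurable_cong_sets)
  show thesis
  proof (rule that[OF spg spr])
    fix \<alpha> z
    show "tail_integral \<alpha> \<nu>\<^sub>1 z = tail_integral \<alpha> (density \<nu> g) z + tail_integral \<alpha> (density \<nu> (\<lambda>x. f1 x - g x)) z"
      unfolding tail_integral_def
      by (subst d1[symmetric], rule add) (auto intro!: meas g G.integrable_max_weight R1.integrable_max_weight)
    show "tail_integral \<alpha> \<nu>\<^sub>2 z = tail_integral \<alpha> (density \<nu> g) z + tail_integral \<alpha> (density \<nu> (\<lambda>x. f2 x - g x)) z"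
      unfolding tail_integral_def
      by (subst d2[symmetric], rule add) (auto intro!: meas g G.integrable_max_weight R2.integrable_max_weight)
  next
    fix j
    show "(\<integral>u. u $ j \<partial>\<nu>\<^sub>1) = (\<integral>u. u $ j \<partial>density \<nu> g) + (\<integral>u. u $ j \<partial>density \<nu> (\<lambda>x. f1 x - g x))"
      by (subst d1[symmetric], rule add) (auto intro!: meas g G.integrable_nth R1.integrable_nth)
    show "(\<integral>u. u $ j \<partial>\<nu>\<^sub>2) = (\<integral>u. u $ j \<partial>density \<nu> g) + (\<integral>u. u $ j \<partial>density \<nu> (\<lambda>x. f2 x - g x))"
      by (subst d2[symmetric], rule add) (auto intro!: meas g G.integrable_nth R2.integrable_nth)
  next
    have "tv_dist \<nu>\<^sub>1 \<nu>\<^sub>2 = (\<integral>\<^sup>+u. ennreal \<bar>f2 u - f1 u\<bar> \<partial>\<nu>)"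
      by (simp add: tv_dist_def Let_def \<nu>_def f1_def f2_def)
    also have "\<dots> = (\<integral>\<^sup>+u. ennreal (f1 u - g u) + ennreal (f2 u - g u) \<partial>\<nu>)"
      by (intro nn_integral_cong) (use g in \<open>auto simp: g_def min_def simp flip: ennreal_plus\<close>)
    also have "\<dots> = (\<integral>\<^sup>+u. ennreal (f1 u - g u) \<partial>\<nu>) + (\<integral>\<^sup>+u. ennreal (f2 u - g u) \<partial>\<nu>)"
      by (rule nn_integral_add) auto
    also have "\<dots> = emeasure (density \<nu> (\<lambda>x. f1 x - g x)) (space \<nu>) + emeasure (density \<nu> (\<lambda>x. f2 x - g x)) (space \<nu>)"
      by (simp add: emeasure_density cong: nn_integral_cong)
    finally show "tv_dist \<nu>\<^sub>1 \<nu>\<^sub>2 = ennreal (measure (density \<nu> (\<lambda>x. f1 x - g x)) (space (density \<nu> (\<lambda>x. f1 x - g x))) +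
        measure (density \<nu> (\<lambda>x. f2 x - g x)) (space (density \<nu> (\<lambda>x. f2 x - g x))))"
      by (simp add: R1.emeasure_eq_measure R2.emeasure_eq_measure)
  qed
qed

text \<open>For \<open>x \<le> y\<close>, factor \<open>exp (- x)\<close> out of the difference and
  bound \<open>1 - exp (- (y - x))\<close> by \<open>y - x\<close>. The factor
  \<open>exp (- m)\<close> is kept because it later absorbs a factor \<open>m\<close>.\<close>

lemma abs_exp_neg_diff_le:
  fixes a b m :: real
  assumes "m \<le> a" "m \<le> b"
  shows "\<bar>exp (- a) - exp (- b)\<bar> \<le> exp (- m) * \<bar>a - b\<bar>"
proof -
  have *: "exp (- x) - exp (- y) \<le> exp (- m) * (y - x)" if "m \<le> x" "x \<le> y" for x y :: real
  proof -
    have "exp (- x) - exp (- y) = exp (- x) * (1 - exp (- (y - x)))"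
      by (simp add: algebra_simps mult_exp_exp)
    also have "\<dots> \<le> exp (- m) * (y - x)"
    proof (rule mult_mono)
      show "1 - exp (- (y - x)) \<le> y - x"
        using exp_ge_add_one_self[of "- (y - x)"] by linarith
    qed (use that in auto)
    finally show ?thesis .
  qed
  show ?thesis
    using *[of a b] *[of b a] assms by (cases "a \<le> b") auto
qed

text \<open>Put \<open>m = max_weight \<alpha> z 1\<close>. Unit first moments make both tail
  integrals at least \<open>m\<close>; the common part cancels, so they differ by at most
  \<open>m\<close> times the total variation distance; and
  \<open>exp (- m) * m \<le> 1\<close>.\<close>

lemma abs_exp_tail_integral_diff_le:
  assumes sp: "spherical_measure \<nu>\<^sub>1 S" "spherical_measure \<nu>\<^sub>2 S"
    and mean: "\<And>j. (\<integral>u. u $ j \<partial>\<nu>\<^sub>1) = 1" "\<And>j. (\<integral>u. u $ j \<partial>\<nu>\<^sub>2) = 1"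
  shows "ennreal \<bar>exp (- tail_integral \<alpha> \<nu>\<^sub>1 z) - exp (- tail_integral \<alpha> \<nu>\<^sub>2 z)\<bar> \<le> tv_dist \<nu>\<^sub>1 \<nu>\<^sub>2"
proof -
  obtain \<kappa> \<rho>\<^sub>1 \<rho>\<^sub>2 where sp': "spherical_measure \<rho>\<^sub>1 S" "spherical_measure \<rho>\<^sub>2 S"
    and tail: "\<And>\<alpha> z. tail_integral \<alpha> \<nu>\<^sub>1 z = tail_integral \<alpha> \<kappa> z + tail_integral \<alpha> \<rho>\<^sub>1 z"
      "\<And>\<alpha> z. tail_integral \<alpha> \<nu>\<^sub>2 z = tail_integral \<alpha> \<kappa> z + tail_integral \<alpha> \<rho>\<^sub>2 z"
    and tv: "tv_dist \<nu>\<^sub>1 \<nu>\<^sub>2 = ennreal (measure \<rho>\<^sub>1 (space \<rho>\<^sub>1) + measure \<rho>\<^sub>2 (space \<rho>\<^sub>2))"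
    using spherical_common_part[OF sp] by metis
  interpret R1: spherical_measure \<rho>\<^sub>1 S by fact
  interpret R2: spherical_measure \<rho>\<^sub>2 S by fact
  let ?m = "max_weight \<alpha> z 1"
  let ?T = "measure \<rho>\<^sub>1 (space \<rho>\<^sub>1) + measure \<rho>\<^sub>2 (space \<rho>\<^sub>2)"
  have ge: "?m \<le> tail_integral \<alpha> \<nu> z" if "spherical_measure \<nu> S" "\<And>j. (\<integral>u. u $ j \<partial>\<nu>) = 1" for \<nu>
    using spherical_measure.tail_integral_ge[OF that(1)] that(2) by (intro max_weight_le) (metis mult_1 one_index)
  have "\<bar>exp (- tail_integral \<alpha> \<nu>\<^sub>1 z) - exp (- tail_integral \<alpha> \<nu>\<^sub>2 z)\<bar> \<le>
      exp (- ?m) * \<bar>tail_integral \<alpha> \<nu>\<^sub>1 z - tail_integral \<alpha> \<nu>\<^sub>2 z\<bar>"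
    by (intro abs_exp_neg_diff_le ge sp mean)
  also have "\<bar>tail_integral \<alpha> \<nu>\<^sub>1 z - tail_integral \<alpha> \<nu>\<^sub>2 z\<bar> \<le> ?m * ?T"
    using R1.tail_integral_nonneg[of \<alpha> z] R2.tail_integral_nonneg[of \<alpha> z]
      R1.tail_integral_le[of \<alpha> z] R2.tail_integral_le[of \<alpha> z]
    by (simp add: tail algebra_simps)
  also have "exp (- ?m) * (?m * ?T) \<le> 1 * ?T"
    unfolding mult.assoc[symmetric]
  proof (rule mult_right_mono)
    show "exp (- ?m) * ?m \<le> 1"
    proof -
      have "?m \<le> exp ?m" using exp_ge_add_one_self[of ?m] by linarith
      then show ?thesis by (simp add: exp_minus field_simps)
    qed
  qed simp
  finally show ?thesis unfolding tv by (intro ennreal_leI) simp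
qed

text \<open>A point in all \<open>A j\<close> but not in all \<open>B j\<close> lies in some
  \<open>A j - B j\<close>. By nesting, the probability of that set is either 0 or exactly the
  difference of the two probabilities.\<close>

lemma (in prob_space) abs_prob_Inter_diff_le:
  fixes A B :: "'i::finite \<Rightarrow> 'a set"
  assumes [measurable]: "\<And>j. A j \<in> events" "\<And>j. B j \<in> events"
    and nested: "\<And>j. A j \<subseteq> B j \<or> B j \<subseteq> A j"
  shows "\<bar>prob (\<Inter>j. A j) - prob (\<Inter>j. B j)\<bar> \<le> (\<Sum>j\<in>UNIV. \<bar>prob (A j) - prob (B j)\<bar>)"
proof -
  have *: "prob (\<Inter>j. A j) - prob (\<Inter>j. B j) \<le> (\<Sum>j\<in>UNIV. \<bar>prob (A j) - prob (B j)\<bar>)"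
    if [measurable]: "\<And>j. A j \<in> events" "\<And>j. B j \<in> events"
      and nested: "\<And>j. A j \<subseteq> B j \<or> B j \<subseteq> A j" for A B :: "'i \<Rightarrow> 'a set"
  proof -
    have "prob (\<Inter>j. A j) \<le> prob ((\<Inter>j. B j) \<union> (\<Union>j. A j - B j))"
      by (intro finite_measure_mono) auto
    also have "\<dots> \<le> prob (\<Inter>j. B j) + prob (\<Union>j. A j - B j)"
      by (intro measure_Un_le) auto
    also have "prob (\<Union>j. A j - B j) \<le> (\<Sum>j\<in>UNIV. prob (A j - B j))"
      by (intro finite_measure_subadditive_finite) auto
    also have "\<dots> \<le> (\<Sum>j\<in>UNIV. \<bar>prob (A j) - prob (B j)\<bar>)"
    proof (rule sum_mono)
      fix j
      show "prob (A j - B j) \<le> \<bar>prob (A j) - prob (B j)\<bar>"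
      proof (cases "A j \<subseteq> B j")
        case True
        then have "prob (A j - B j) = 0" by (metis Diff_eq_empty_iff measure_empty)
        then show ?thesis by simp
      next
        case False
        then have "B j \<subseteq> A j" using nested by blast
        then show ?thesis by (simp add: finite_measure_Diff)
      qed
    qed
    finally show ?thesis by simp
  qed
  show ?thesis
    unfolding abs_le_iff[of "prob (\<Inter>j. A j) - prob (\<Inter>j. B j)"]
    using *[of A B] *[of B A] assms by (simp add: abs_minus_commute disj_commute)
qed

text \<open>The vector and its power live on one space, and for each coordinate both events are
  upper bounds on \<open>Z \<omega> $ j\<close>, hence nested. What remains is the Frechet
  marginals, handled by \<open>exp_neg_powr_diff_le\<close> with
  \<open>t = (z $ j) powr - \<alpha>\<close> and
  \<open>\<beta> = \<alpha>' / \<alpha>\<close>.\<close>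

lemma (in spherical_measure) kolmogorov_vpowr:
  assumes Z: "max_stable_vector M Z \<alpha> \<rho>" and \<alpha>: "0 < \<alpha>" "\<alpha> \<le> \<alpha>'"
    and mean: "\<And>j. (\<integral>u. u $ j \<partial>\<rho>) = 1" and z: "z \<in> pos_orthant"
  shows "\<bar>measure M {\<omega>\<in>space M. Z \<omega> \<le> z} - exp (- tail_integral \<alpha>' \<rho> z)\<bar> \<le>
    real CARD('d) * (\<alpha>' / \<alpha> - \<alpha> / \<alpha>')"
proof -
  interpret M: prob_space M using Z by (rule max_stable_vectorD)
  have \<alpha>': "0 < \<alpha>'" using \<alpha> by simp
  let ?Z = "\<lambda>\<omega>. vpowr (Z \<omega>) (\<alpha> / \<alpha>')"
  have Z': "max_stable_vector M ?Z \<alpha>' \<rho>" by (rule max_stable_vector_vpowr[OF Z \<alpha>(1) \<alpha>'])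
  have [measurable]: "Z \<in> borel_measurable M" "?Z \<in> borel_measurable M"
    using max_stable_vectorD(2) Z Z' by blast+
  let ?A = "\<lambda>j. {\<omega>\<in>space M. Z \<omega> $ j \<le> z $ j}" and ?B = "\<lambda>j. {\<omega>\<in>space M. ?Z \<omega> $ j \<le> z $ j}"
  have zj: "0 < z $ j" for j using z by (simp add: pos_orthant_def)
  have A: "measure M (?A j) = exp (- ((z $ j) powr - \<alpha>))"
    and B: "measure M (?B j) = exp (- ((z $ j) powr - \<alpha>'))" for j
    using frechet_variable_nth[OF Z \<alpha>(1) mean, of j] frechet_variable_nth[OF Z' \<alpha>' mean, of j] zj[of j]
    by (simp_all add: frechet_variable_def)
  have "measure M {\<omega>\<in>space M. Z \<omega> \<le> z} = measure M (\<Inter>j. ?A j)"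
    by (auto simp: vec_le_iff intro!: arg_cong[where f="measure M"])
  moreover have "exp (- tail_integral \<alpha>' \<rho> z) = measure M (\<Inter>j. ?B j)"
    unfolding max_stable_vector_cdf(2)[OF Z' \<alpha>' z, symmetric]
    by (auto simp: vec_le_iff intro!: arg_cong[where f="measure M"])
  moreover have "\<bar>measure M (\<Inter>j. ?A j) - measure M (\<Inter>j. ?B j)\<bar> \<le>
      (\<Sum>j\<in>UNIV. \<bar>measure M (?A j) - measure M (?B j)\<bar>)"
  proof (rule M.abs_prob_Inter_diff_le)
    fix j
    have "x powr (\<alpha> / \<alpha>') \<le> z $ j \<longleftrightarrow> x \<le> (z $ j) powr (\<alpha>' / \<alpha>)" if "0 < x" for x :: real
      using that \<alpha> \<alpha>' zj[of j] by (subst (1 2) ln_le_cancel_iff[symmetric]) (auto simp: ln_powr field_simps)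
    then have B_eq: "?B j = {\<omega>\<in>space M. Z \<omega> $ j \<le> (z $ j) powr (\<alpha>' / \<alpha>)}"
      using max_stable_vectorD(3)[OF Z] by (auto simp: vpowr_def)
    show "?A j \<subseteq> ?B j \<or> ?B j \<subseteq> ?A j"
    proof (cases "z $ j \<le> (z $ j) powr (\<alpha>' / \<alpha>)")
      case True
      then have "?A j \<subseteq> ?B j" unfolding B_eq by (auto intro: order_trans)
      then show ?thesis ..
    next
      case False
      then have "?B j \<subseteq> ?A j" unfolding B_eq by (auto intro: order_trans)
      then show ?thesis ..
    qed
  qed measurable
  moreover have "\<bar>measure M (?A j) - measure M (?B j)\<bar> \<le> \<alpha>' / \<alpha> - \<alpha> / \<alpha>'" for j
    using exp_neg_powr_diff_le[of "(z $ j) powr - \<alpha>" "\<alpha>' / \<alpha>"] zj[of j] \<alpha> \<alpha>'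
    by (simp add: A B powr_powr less_imp_neq[symmetric])
  then have "(\<Sum>j\<in>(UNIV :: 'd set). \<bar>measure M (?A j) - measure M (?B j)\<bar>) \<le> (\<Sum>j\<in>(UNIV :: 'd set). \<alpha>' / \<alpha> - \<alpha> / \<alpha>')"
    by (intro sum_mono)
  ultimately show ?thesis by simp
qed

section \<open>Wasserstein distance\<close>

text \<open>Monotonicity supplies Borel measurability; the lower bound holds because the minimum is
  at most \<open>\<zeta>\<close>.\<close>

lemma frechet_min_prob:
  assumes \<zeta>: "frechet_variable M \<zeta> \<alpha>\<^sub>1"
  shows "mono (min_prob M \<zeta> \<alpha>\<^sub>1 \<alpha>\<^sub>2)" and "0 < t \<Longrightarrow> exp (- (t powr - \<alpha>\<^sub>1)) \<le> min_prob M \<zeta> \<alpha>\<^sub>1 \<alpha>\<^sub>2 t"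
proof -
  interpret prob_space M using \<zeta> by (simp add: frechet_variable_def)
  have [measurable]: "\<zeta> \<in> borel_measurable M" using \<zeta> by (simp add: frechet_variable_def)
  show "mono (min_prob M \<zeta> \<alpha>\<^sub>1 \<alpha>\<^sub>2)"
    unfolding min_prob_def by (intro monoI finite_measure_mono) auto
  assume "0 < t"
  then have "exp (- (t powr - \<alpha>\<^sub>1)) = prob {\<omega>\<in>space M. \<zeta> \<omega> \<le> t}"
    using \<zeta> by (simp add: frechet_variable_def)
  also have "\<dots> \<le> min_prob M \<zeta> \<alpha>\<^sub>1 \<alpha>\<^sub>2 t"
    unfolding min_prob_def by (intro finite_measure_mono) auto
  finally show "exp (- (t powr - \<alpha>\<^sub>1)) \<le> min_prob M \<zeta> \<alpha>\<^sub>1 \<alpha>\<^sub>2 t" .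
qed

text \<open>The Frechet distribution function is replaced by the larger \<open>min_prob\<close>, and
  unit first moments turn the radial integral, once for each coordinate, into an integral against
  the exponent measure.\<close>

lemma (in spherical_measure) C_W_ge:
  assumes \<alpha>: "0 < \<alpha>\<^sub>1" and \<zeta>: "frechet_variable M \<zeta> \<alpha>\<^sub>1" and mean: "\<And>j. (\<integral>u. u $ j \<partial>\<rho>) = 1"
  shows "of_nat CARD('d) * (\<integral>\<^sup>+r. ennreal (max 1 r * \<bar>ln r\<bar> * exp (- (r powr - \<alpha>\<^sub>1))) \<partial>radial_measure \<alpha>\<^sub>1)
    \<le> C_W M \<zeta> \<alpha>\<^sub>1 \<alpha>\<^sub>2 \<rho>"
proof -
  let ?F = "\<lambda>r. if r = 0 then 0 else ennreal (max 1 r * \<bar>ln r\<bar> * min_prob M \<zeta> \<alpha>\<^sub>1 \<alpha>\<^sub>2 r)"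
  have [measurable]: "min_prob M \<zeta> \<alpha>\<^sub>1 \<alpha>\<^sub>2 \<in> borel_measurable borel"
    by (intro borel_measurable_mono frechet_min_prob[OF \<zeta>])
  have "(\<integral>\<^sup>+r. ennreal (max 1 r * \<bar>ln r\<bar> * exp (- (r powr - \<alpha>\<^sub>1))) \<partial>radial_measure \<alpha>\<^sub>1) \<le>
      (\<integral>\<^sup>+r. ?F r \<partial>radial_measure \<alpha>\<^sub>1)"
  proof (rule nn_integral_mono)
    fix r assume "r \<in> space (radial_measure \<alpha>\<^sub>1)"
    then have "0 < r" by (simp add: space_radial_measure)
    then show "ennreal (max 1 r * \<bar>ln r\<bar> * exp (- (r powr - \<alpha>\<^sub>1))) \<le> ?F r"
      using frechet_min_prob(2)[OF \<zeta>] by (auto intro!: ennreal_leI mult_left_mono)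
  qed
  also have "\<dots> = (\<integral>\<^sup>+y. ?F (y $ j) \<partial>exponent_measure \<alpha>\<^sub>1 \<rho>)" for j
    by (subst nn_integral_exponent_measure_nth[OF \<alpha>]) (auto simp: mean)
  finally have "(\<Sum>j\<in>(UNIV :: 'd set). \<integral>\<^sup>+r. ennreal (max 1 r * \<bar>ln r\<bar> * exp (- (r powr - \<alpha>\<^sub>1))) \<partial>radial_measure \<alpha>\<^sub>1)
      \<le> (\<Sum>j\<in>UNIV. \<integral>\<^sup>+y. ?F (y $ j) \<partial>exponent_measure \<alpha>\<^sub>1 \<rho>)"
    by (rule sum_mono)
  also have "\<dots> \<le> C_W M \<zeta> \<alpha>\<^sub>1 \<alpha>\<^sub>2 \<rho>"
    unfolding C_W_def by (rule add_increasing) simp_all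
  finally show ?thesis by simp
qed

text \<open>\<open>Z\<close> is coupled with its own power: each coordinate contributes the distance
  of a Frechet variable to its power with exponent \<open>\<alpha> / \<alpha>'\<close>.\<close>

lemma (in spherical_measure) wasserstein_vpowr:
  assumes Z: "max_stable_vector M Z \<alpha> \<rho>" and \<alpha>: "1 < \<alpha>" "\<alpha> \<le> \<alpha>'"
    and mean: "\<And>j. (\<integral>u. u $ j \<partial>\<rho>) = 1" and h: "l1_lipschitz h"
  shows "ennreal \<bar>(\<integral>\<omega>. h (Z \<omega>) \<partial>M) - (\<integral>\<omega>. h (vpowr (Z \<omega>) (\<alpha> / \<alpha>')) \<partial>M)\<bar> \<le>
    ennreal (1 - \<alpha> / \<alpha>') * (of_nat CARD('d) *
      (\<integral>\<^sup>+r. ennreal (max 1 r * \<bar>ln r\<bar> * exp (- (r powr - \<alpha>))) \<partial>radial_measure \<alpha>))"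
proof -
  interpret M: prob_space M using Z by (rule max_stable_vectorD)
  have \<alpha>0: "0 < \<alpha>" "0 < \<alpha>'" using \<alpha> by simp_all
  let ?Z = "\<lambda>\<omega>. vpowr (Z \<omega>) (\<alpha> / \<alpha>')"
  have Z': "max_stable_vector M ?Z \<alpha>' \<rho>" by (rule max_stable_vector_vpowr[OF Z \<alpha>0])
  have [measurable]: "Z \<in> borel_measurable M" "?Z \<in> borel_measurable M"
    using max_stable_vectorD(2) Z Z' by blast+
  have fr: "frechet_variable M (\<lambda>\<omega>. Z \<omega> $ j) \<alpha>" for j
    by (rule frechet_variable_nth[OF Z \<alpha>0(1) mean])
  have int: "integrable M (\<lambda>\<omega>. Z \<omega> $ j)" "integrable M (\<lambda>\<omega>. ?Z \<omega> $ j)" for j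
    using frechet_variable_expectation(1)[OF fr \<alpha>(1)] \<alpha>
      frechet_variable_expectation(1)[OF frechet_variable_nth[OF Z' \<alpha>0(2) mean]] by simp_all
  have "ennreal \<bar>(\<integral>\<omega>. h (Z \<omega>) \<partial>M) - (\<integral>\<omega>. h (?Z \<omega>) \<partial>M)\<bar> \<le>
      ennreal (\<Sum>j\<in>UNIV. \<integral>\<omega>. \<bar>Z \<omega> $ j - ?Z \<omega> $ j\<bar> \<partial>M)"
    by (intro ennreal_leI l1_lipschitz_expectation_diff h M.finite_measure_axioms int) measurable
  also have "\<dots> = (\<Sum>j\<in>UNIV. ennreal (\<integral>\<omega>. \<bar>Z \<omega> $ j - ?Z \<omega> $ j\<bar> \<partial>M))"
    by (rule sum_ennreal[symmetric]) simp
  also have "\<dots> \<le> (\<Sum>j\<in>(UNIV :: 'd set). ennreal (1 - \<alpha> / \<alpha>') *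
      (\<integral>\<^sup>+r. ennreal (max 1 r * \<bar>ln r\<bar> * exp (- (r powr - \<alpha>))) \<partial>radial_measure \<alpha>))"
  proof (rule sum_mono)
    fix j
    have "ennreal (\<integral>\<omega>. \<bar>Z \<omega> $ j - ?Z \<omega> $ j\<bar> \<partial>M) = (\<integral>\<^sup>+\<omega>. ennreal \<bar>Z \<omega> $ j - (Z \<omega> $ j) powr (\<alpha> / \<alpha>')\<bar> \<partial>M)"
      using int[of j] by (subst nn_integral_eq_integral) (auto simp: vpowr_def)
    also have "\<dots> \<le> ennreal (1 - \<alpha> / \<alpha>') *
      (\<integral>\<^sup>+r. ennreal (max 1 r * \<bar>ln r\<bar> * exp (- (r powr - \<alpha>))) \<partial>radial_measure \<alpha>)"
      using \<alpha> by (intro frechet_variable_powr_distance fr) auto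
    finally show "ennreal (\<integral>\<omega>. \<bar>Z \<omega> $ j - ?Z \<omega> $ j\<bar> \<partial>M) \<le> ennreal (1 - \<alpha> / \<alpha>') *
      (\<integral>\<^sup>+r. ennreal (max 1 r * \<bar>ln r\<bar> * exp (- (r powr - \<alpha>))) \<partial>radial_measure \<alpha>)" .
  qed
  finally show ?thesis by (simp add: mult.left_commute)
qed

text \<open>Both vectors, possibly on different spaces, are compared with one law \<open>P\<close>,
  the truncated max-stable law of the common part. The masses of the two remainders add up to the
  total variation distance.\<close>

lemma wasserstein_same_index:
  fixes h :: "real^'d \<Rightarrow> real"
  assumes sp: "spherical_measure \<nu>\<^sub>1 S" "spherical_measure \<nu>\<^sub>2 S"
    and mean: "\<And>j. (\<integral>u. u $ j \<partial>\<nu>\<^sub>1) = 1" "\<And>j. (\<integral>u. u $ j \<partial>\<nu>\<^sub>2) = 1"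
    and \<alpha>: "1 < \<alpha>" and Z: "max_stable_vector M\<^sub>1 Z\<^sub>1 \<alpha> \<nu>\<^sub>1" "max_stable_vector M\<^sub>2 Z\<^sub>2 \<alpha> \<nu>\<^sub>2"
    and h: "l1_lipschitz h"
  shows "ennreal \<bar>(\<integral>\<omega>. h (Z\<^sub>1 \<omega>) \<partial>M\<^sub>1) - (\<integral>\<omega>. h (Z\<^sub>2 \<omega>) \<partial>M\<^sub>2)\<bar> \<le>
    of_nat CARD('d) * ennreal (Gamma (1 - 1 / \<alpha>)) * tv_dist \<nu>\<^sub>1 \<nu>\<^sub>2"
proof -
  obtain \<kappa> \<rho>\<^sub>1 \<rho>\<^sub>2 where sp': "spherical_measure \<kappa> S" "spherical_measure \<rho>\<^sub>1 S" "spherical_measure \<rho>\<^sub>2 S"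
    and tail: "\<And>\<alpha> z. tail_integral \<alpha> \<nu>\<^sub>1 z = tail_integral \<alpha> \<kappa> z + tail_integral \<alpha> \<rho>\<^sub>1 z"
      "\<And>\<alpha> z. tail_integral \<alpha> \<nu>\<^sub>2 z = tail_integral \<alpha> \<kappa> z + tail_integral \<alpha> \<rho>\<^sub>2 z"
    and means: "\<And>j. (\<integral>u. u $ j \<partial>\<nu>\<^sub>1) = (\<integral>u. u $ j \<partial>\<kappa>) + (\<integral>u. u $ j \<partial>\<rho>\<^sub>1)"
      "\<And>j. (\<integral>u. u $ j \<partial>\<nu>\<^sub>2) = (\<integral>u. u $ j \<partial>\<kappa>) + (\<integral>u. u $ j \<partial>\<rho>\<^sub>2)"
    and tv: "tv_dist \<nu>\<^sub>1 \<nu>\<^sub>2 = ennreal (measure \<rho>\<^sub>1 (space \<rho>\<^sub>1) + measure \<rho>\<^sub>2 (space \<rho>\<^sub>2))"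
    using spherical_common_part[OF sp] by blast
  have means': "(\<integral>u. u $ j \<partial>\<kappa>) + (\<integral>u. u $ j \<partial>\<rho>\<^sub>1) = 1" "(\<integral>u. u $ j \<partial>\<kappa>) + (\<integral>u. u $ j \<partial>\<rho>\<^sub>2) = 1" for j
    using means[of j] mean[of j] by simp_all
  let ?d = "real CARD('d)" and ?G = "Gamma (1 - 1 / \<alpha>)"
  let ?m1 = "measure \<rho>\<^sub>1 (space \<rho>\<^sub>1)" and ?m2 = "measure \<rho>\<^sub>2 (space \<rho>\<^sub>2)"
  have "\<bar>(\<integral>\<omega>. h (Z\<^sub>1 \<omega>) \<partial>M\<^sub>1) - (\<integral>\<omega>. h (Z\<^sub>2 \<omega>) \<partial>M\<^sub>2)\<bar> \<le> ?d * ?G * (?m1 + ?m2)"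
  proof (rule field_le_epsilon)
    fix e :: real assume "0 < e"
    \<comment> \<open>Chosen so that the two truncation errors \<open>?d * \<epsilon>\<close> add up
      to \<open>e\<close>.\<close>
    define \<epsilon> where "\<epsilon> = e / (2 * ?d)"
    have \<epsilon>: "0 < \<epsilon>" using \<open>0 < e\<close> by (simp add: \<epsilon>_def)
    obtain P where P: "prob_space P" "sets P = sets borel" "AE w in P. \<forall>i. \<epsilon> \<le> w $ i"
      "\<And>z. (\<And>i. \<epsilon> \<le> z $ i) \<Longrightarrow> measure P {..z} = exp (- tail_integral \<alpha> \<kappa> z)"
      using spherical_measure.stable_max_exists[OF sp'(1) _ \<epsilon>, of \<alpha>] \<alpha> by auto
    have "\<bar>(\<integral>\<omega>. h (Z\<^sub>1 \<omega>) \<partial>M\<^sub>1) - (\<integral>w. h w \<partial>P)\<bar> \<le> ?d * \<epsilon> + ?d * ?G * ?m1"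
      by (rule wasserstein_minorant[OF sp(1) sp'(1,2) tail(1) mean(1) means'(1) \<alpha> \<epsilon> Z(1) P h])
    moreover have "\<bar>(\<integral>\<omega>. h (Z\<^sub>2 \<omega>) \<partial>M\<^sub>2) - (\<integral>w. h w \<partial>P)\<bar> \<le> ?d * \<epsilon> + ?d * ?G * ?m2"
      by (rule wasserstein_minorant[OF sp(2) sp'(1,3) tail(2) mean(2) means'(2) \<alpha> \<epsilon> Z(2) P h])
    moreover have "?d * \<epsilon> + ?d * \<epsilon> = e" by (simp add: \<epsilon>_def)
    moreover have "?d * ?G * (?m1 + ?m2) = ?d * ?G * ?m1 + ?d * ?G * ?m2" by (rule distrib_left)
    ultimately show "\<bar>(\<integral>\<omega>. h (Z\<^sub>1 \<omega>) \<partial>M\<^sub>1) - (\<integral>\<omega>. h (Z\<^sub>2 \<omega>) \<partial>M\<^sub>2)\<bar> \<le> ?d * ?G * (?m1 + ?m2) + e"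
      by linarith
  qed
  moreover have "0 \<le> ?G" using \<alpha> by (intro less_imp_le Gamma_real_pos) auto
  ultimately show ?thesis
    unfolding tv ennreal_of_nat_eq_real_of_nat by (simp add: ennreal_leI flip: ennreal_mult del: ennreal_plus)
qed

text \<open>The coordinate-wise positive part fixes the orthant and does not increase the l1
  distance. The extension is Lipschitz everywhere, hence Borel, whereas the functions in the
  Wasserstein distance are constrained on the orthant only.\<close>

lemma l1_lipschitz_extension:
  fixes h :: "real^'d \<Rightarrow> real"
  assumes "\<forall>x\<in>{0..}. \<forall>y\<in>{0..}. \<bar>h x - h y\<bar> \<le> l1_norm (x - y)"
  shows "l1_lipschitz (\<lambda>x. h (vmax 0 x))"
  unfolding l1_lipschitz_def
proof (intro allI)
  fix x y :: "real^'d"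
  have "\<bar>h (vmax 0 x) - h (vmax 0 y)\<bar> \<le> l1_norm (vmax 0 x - vmax 0 y)"
    using assms by (simp add: vec_le_iff)
  also have "\<dots> \<le> l1_norm (x - y)"
    unfolding l1_norm_def by (intro sum_mono) auto
  finally show "\<bar>h (vmax 0 x) - h (vmax 0 y)\<bar> \<le> l1_norm (x - y)" .
qed

theorem corollary10:
  fixes N :: "real^'d \<Rightarrow> real"
    and \<alpha>\<^sub>1 \<alpha>\<^sub>2 :: real
    and \<nu>\<^sub>1 \<nu>\<^sub>2 :: "(real^'d) measure"
    and M\<^sub>1 :: "'a measure" and Z\<^sub>1 :: "'a \<Rightarrow> real^'d"
    and M\<^sub>2 :: "'b measure" and Z\<^sub>2 :: "'b \<Rightarrow> real^'d"
    and M\<^sub>0 :: "'c measure" and \<zeta> :: "'c \<Rightarrow> real"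
  assumes "is_norm N" and "pos_sphere N \<subseteq> {0..1}"
    and "0 < \<alpha>\<^sub>1" and "\<alpha>\<^sub>1 < \<alpha>\<^sub>2"
    and "angular_measure N \<nu>\<^sub>1" and "angular_measure N \<nu>\<^sub>2"
    and "max_stable_vector M\<^sub>1 Z\<^sub>1 \<alpha>\<^sub>1 \<nu>\<^sub>1"
    and "max_stable_vector M\<^sub>2 Z\<^sub>2 \<alpha>\<^sub>2 \<nu>\<^sub>2"
    and "frechet_variable M\<^sub>0 \<zeta> \<alpha>\<^sub>1"
  shows "kolmogorov_dist M\<^sub>1 Z\<^sub>1 M\<^sub>2 Z\<^sub>2
           \<le> C_K M\<^sub>0 \<zeta> \<alpha>\<^sub>1 \<alpha>\<^sub>2 \<nu>\<^sub>1 * ennreal ((1 / \<alpha>\<^sub>1 + 1 / \<alpha>\<^sub>2) * \<bar>\<alpha>\<^sub>1 - \<alpha>\<^sub>2\<bar>)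
             + of_nat CARD('d) * tv_dist \<nu>\<^sub>1 \<nu>\<^sub>2
       \<and>
         (1 < \<alpha>\<^sub>1 \<and> 1 < \<alpha>\<^sub>2 \<longrightarrow>
          wasserstein_dist M\<^sub>1 Z\<^sub>1 M\<^sub>2 Z\<^sub>2
           \<le> C_W M\<^sub>0 \<zeta> \<alpha>\<^sub>1 \<alpha>\<^sub>2 \<nu>\<^sub>1 * ennreal ((1 / \<alpha>\<^sub>1 + 1 / \<alpha>\<^sub>2) * \<bar>\<alpha>\<^sub>1 - \<alpha>\<^sub>2\<bar>)
             + of_nat CARD('d) * ennreal (Gamma (1 - 1 / \<alpha>\<^sub>2)) * tv_dist \<nu>\<^sub>1 \<nu>\<^sub>2)"
proof (intro conjI impI)
  let ?S = "pos_sphere N" and ?d = "real CARD('d)"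
  have sp: "spherical_measure \<nu>\<^sub>1 ?S" "spherical_measure \<nu>\<^sub>2 ?S"
    using angular_measure_spherical assms(1,2,5,6) by blast+
  interpret A: spherical_measure \<nu>\<^sub>1 ?S by fact
  interpret B: spherical_measure \<nu>\<^sub>2 ?S by fact
  have mean: "(\<integral>u. u $ j \<partial>\<nu>\<^sub>1) = 1" "(\<integral>u. u $ j \<partial>\<nu>\<^sub>2) = 1" for j
    using assms(5,6) by (auto simp: angular_measure_def)
  have \<alpha>\<^sub>2: "0 < \<alpha>\<^sub>2" using assms(3,4) by simp
  have factor: "(1 / \<alpha>\<^sub>1 + 1 / \<alpha>\<^sub>2) * \<bar>\<alpha>\<^sub>1 - \<alpha>\<^sub>2\<bar> = \<alpha>\<^sub>2 / \<alpha>\<^sub>1 - \<alpha>\<^sub>1 / \<alpha>\<^sub>2"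
    using assms(3,4) by (simp add: field_simps)
  have ratio: "\<alpha>\<^sub>1 / \<alpha>\<^sub>2 \<le> 1" "1 \<le> \<alpha>\<^sub>2 / \<alpha>\<^sub>1" using assms(3,4) by simp_all
  let ?D = "\<alpha>\<^sub>2 / \<alpha>\<^sub>1 - \<alpha>\<^sub>1 / \<alpha>\<^sub>2"
  have D: "0 \<le> ?D" "1 - \<alpha>\<^sub>1 / \<alpha>\<^sub>2 \<le> ?D" using ratio by linarith+

  show "kolmogorov_dist M\<^sub>1 Z\<^sub>1 M\<^sub>2 Z\<^sub>2
       \<le> C_K M\<^sub>0 \<zeta> \<alpha>\<^sub>1 \<alpha>\<^sub>2 \<nu>\<^sub>1 * ennreal ((1 / \<alpha>\<^sub>1 + 1 / \<alpha>\<^sub>2) * \<bar>\<alpha>\<^sub>1 - \<alpha>\<^sub>2\<bar>)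
         + of_nat CARD('d) * tv_dist \<nu>\<^sub>1 \<nu>\<^sub>2"
    unfolding kolmogorov_dist_def factor
  proof (rule SUP_least)
    fix z :: "real^'d" assume z: "z \<in> pos_orthant"
    let ?F = "\<lambda>\<nu>. exp (- tail_integral \<alpha>\<^sub>2 \<nu> z)"
    \<comment> \<open>The intermediate value \<open>?F \<nu>\<^sub>1\<close> is the distribution
      function of the max-stable law with the second index and the first angular measure.\<close>
    have "ennreal \<bar>\<P>(\<omega> in M\<^sub>1. Z\<^sub>1 \<omega> \<le> z) - \<P>(\<omega> in M\<^sub>2. Z\<^sub>2 \<omega> \<le> z)\<bar> \<le>
        ennreal (\<bar>\<P>(\<omega> in M\<^sub>1. Z\<^sub>1 \<omega> \<le> z) - ?F \<nu>\<^sub>1\<bar> + \<bar>?F \<nu>\<^sub>1 - ?F \<nu>\<^sub>2\<bar>)"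
      unfolding B.max_stable_vector_cdf(2)[OF assms(8) \<alpha>\<^sub>2 z] by (intro ennreal_leI) linarith
    also have "\<dots> = ennreal \<bar>\<P>(\<omega> in M\<^sub>1. Z\<^sub>1 \<omega> \<le> z) - ?F \<nu>\<^sub>1\<bar> + ennreal \<bar>?F \<nu>\<^sub>1 - ?F \<nu>\<^sub>2\<bar>"
      by simp
    also have "\<dots> \<le> C_K M\<^sub>0 \<zeta> \<alpha>\<^sub>1 \<alpha>\<^sub>2 \<nu>\<^sub>1 * ennreal ?D + of_nat CARD('d) * tv_dist \<nu>\<^sub>1 \<nu>\<^sub>2"
    proof (rule add_mono)
      have "ennreal \<bar>\<P>(\<omega> in M\<^sub>1. Z\<^sub>1 \<omega> \<le> z) - ?F \<nu>\<^sub>1\<bar> \<le> ennreal (?d * ?D)"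
        using assms(3,4) by (intro ennreal_leI A.kolmogorov_vpowr[OF assms(7)] mean z) auto
      also have "\<dots> = of_nat CARD('d) * ennreal ?D"
        by (simp add: ennreal_mult' ennreal_of_nat_eq_real_of_nat D(1))
      also have "\<dots> \<le> C_K M\<^sub>0 \<zeta> \<alpha>\<^sub>1 \<alpha>\<^sub>2 \<nu>\<^sub>1 * ennreal ?D"
        unfolding C_K_def by (intro mult_right_mono) auto
      finally show "ennreal \<bar>\<P>(\<omega> in M\<^sub>1. Z\<^sub>1 \<omega> \<le> z) - ?F \<nu>\<^sub>1\<bar> \<le> C_K M\<^sub>0 \<zeta> \<alpha>\<^sub>1 \<alpha>\<^sub>2 \<nu>\<^sub>1 * ennreal ?D" .
      have "ennreal \<bar>?F \<nu>\<^sub>1 - ?F \<nu>\<^sub>2\<bar> \<le> 1 * tv_dist \<nu>\<^sub>1 \<nu>\<^sub>2"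
        using abs_exp_tail_integral_diff_le[OF sp mean] by simp
      also have "\<dots> \<le> of_nat CARD('d) * tv_dist \<nu>\<^sub>1 \<nu>\<^sub>2"
        by (intro mult_right_mono) (auto simp: Suc_le_eq)
      finally show "ennreal \<bar>?F \<nu>\<^sub>1 - ?F \<nu>\<^sub>2\<bar> \<le> of_nat CARD('d) * tv_dist \<nu>\<^sub>1 \<nu>\<^sub>2" .
    qed
    finally show "ennreal \<bar>\<P>(\<omega> in M\<^sub>1. Z\<^sub>1 \<omega> \<le> z) - \<P>(\<omega> in M\<^sub>2. Z\<^sub>2 \<omega> \<le> z)\<bar> \<le>
        C_K M\<^sub>0 \<zeta> \<alpha>\<^sub>1 \<alpha>\<^sub>2 \<nu>\<^sub>1 * ennreal ?D + of_nat CARD('d) * tv_dist \<nu>\<^sub>1 \<nu>\<^sub>2" .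
  qed

  assume "1 < \<alpha>\<^sub>1 \<and> 1 < \<alpha>\<^sub>2"
  then have \<alpha>: "1 < \<alpha>\<^sub>1" "1 < \<alpha>\<^sub>2" by auto
  show "wasserstein_dist M\<^sub>1 Z\<^sub>1 M\<^sub>2 Z\<^sub>2
       \<le> C_W M\<^sub>0 \<zeta> \<alpha>\<^sub>1 \<alpha>\<^sub>2 \<nu>\<^sub>1 * ennreal ((1 / \<alpha>\<^sub>1 + 1 / \<alpha>\<^sub>2) * \<bar>\<alpha>\<^sub>1 - \<alpha>\<^sub>2\<bar>)
         + of_nat CARD('d) * ennreal (Gamma (1 - 1 / \<alpha>\<^sub>2)) * tv_dist \<nu>\<^sub>1 \<nu>\<^sub>2"
    unfolding wasserstein_dist_def factor
  proof (rule SUP_least)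
    fix h0 :: "real^'d \<Rightarrow> real"
    assume "h0 \<in> {h. \<forall>x\<in>{0..}. \<forall>y\<in>{0..}. \<bar>h x - h y\<bar> \<le> l1_norm (x - y)}"
    then have h: "l1_lipschitz (\<lambda>x. h0 (vmax 0 x))" (is "l1_lipschitz ?h")
      by (intro l1_lipschitz_extension) simp
    have vmax_0: "vmax 0 x = x" if "0 \<le> x" for x :: "real^'d"
      using that by (simp add: vec_eq_iff vec_le_iff)
    \<comment> \<open>Both vectors take values in the orthant, where \<open>?h\<close> and
      \<open>h0\<close> agree.\<close>
    have eq: "(\<integral>\<omega>. h0 (Z\<^sub>1 \<omega>) \<partial>M\<^sub>1) = (\<integral>\<omega>. ?h (Z\<^sub>1 \<omega>) \<partial>M\<^sub>1)"
      "(\<integral>\<omega>. h0 (Z\<^sub>2 \<omega>) \<partial>M\<^sub>2) = (\<integral>\<omega>. ?h (Z\<^sub>2 \<omega>) \<partial>M\<^sub>2)"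
      using max_stable_vectorD(4)[OF assms(7)] max_stable_vectorD(4)[OF assms(8)]
      by (auto intro!: Bochner_Integration.integral_cong simp: vmax_0)
    \<comment> \<open>The power lives on the space of \<open>Z\<^sub>1\<close>, which makes the
      first comparison a coupling; it shares its index with \<open>Z\<^sub>2\<close>, which leaves
      only the angular measures for the second.\<close>
    let ?Z = "\<lambda>\<omega>. vpowr (Z\<^sub>1 \<omega>) (\<alpha>\<^sub>1 / \<alpha>\<^sub>2)"
    have Z: "max_stable_vector M\<^sub>1 ?Z \<alpha>\<^sub>2 \<nu>\<^sub>1"
      by (rule A.max_stable_vector_vpowr[OF assms(7) assms(3) \<alpha>\<^sub>2])
    let ?I = "\<integral>\<omega>. ?h (Z\<^sub>1 \<omega>) \<partial>M\<^sub>1" and ?J = "\<integral>\<omega>. ?h (?Z \<omega>) \<partial>M\<^sub>1" and ?K = "\<integral>\<omega>. ?h (Z\<^sub>2 \<omega>) \<partial>M\<^sub>2"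
    have "ennreal \<bar>?I - ?K\<bar> \<le> ennreal (\<bar>?I - ?J\<bar> + \<bar>?J - ?K\<bar>)"
      by (intro ennreal_leI) linarith
    also have "\<dots> = ennreal \<bar>?I - ?J\<bar> + ennreal \<bar>?J - ?K\<bar>" by simp
    also have "\<dots> \<le> C_W M\<^sub>0 \<zeta> \<alpha>\<^sub>1 \<alpha>\<^sub>2 \<nu>\<^sub>1 * ennreal ?D
         + of_nat CARD('d) * ennreal (Gamma (1 - 1 / \<alpha>\<^sub>2)) * tv_dist \<nu>\<^sub>1 \<nu>\<^sub>2"
    proof (rule add_mono)
      have "ennreal \<bar>?I - ?J\<bar> \<le> ennreal (1 - \<alpha>\<^sub>1 / \<alpha>\<^sub>2) * (of_nat CARD('d) *
        (\<integral>\<^sup>+r. ennreal (max 1 r * \<bar>ln r\<bar> * exp (- (r powr - \<alpha>\<^sub>1))) \<partial>radial_measure \<alpha>\<^sub>1))"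
        using assms(4) by (intro A.wasserstein_vpowr[OF assms(7) \<alpha>(1) _ mean(1) h]) simp
      also have "\<dots> \<le> ennreal ?D * C_W M\<^sub>0 \<zeta> \<alpha>\<^sub>1 \<alpha>\<^sub>2 \<nu>\<^sub>1"
        by (intro mult_mono ennreal_leI D A.C_W_ge[OF assms(3,9) mean(1)]) auto
      finally show "ennreal \<bar>?I - ?J\<bar> \<le> C_W M\<^sub>0 \<zeta> \<alpha>\<^sub>1 \<alpha>\<^sub>2 \<nu>\<^sub>1 * ennreal ?D"
        by (simp add: mult.commute)
      show "ennreal \<bar>?J - ?K\<bar> \<le> of_nat CARD('d) * ennreal (Gamma (1 - 1 / \<alpha>\<^sub>2)) * tv_dist \<nu>\<^sub>1 \<nu>\<^sub>2"
        by (rule wasserstein_same_index[OF sp mean \<alpha>(2) Z assms(8) h])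
    qed
    finally show "ennreal \<bar>(\<integral>\<omega>. h0 (Z\<^sub>1 \<omega>) \<partial>M\<^sub>1) - (\<integral>\<omega>. h0 (Z\<^sub>2 \<omega>) \<partial>M\<^sub>2)\<bar> \<le>
        C_W M\<^sub>0 \<zeta> \<alpha>\<^sub>1 \<alpha>\<^sub>2 \<nu>\<^sub>1 * ennreal ?D
         + of_nat CARD('d) * ennreal (Gamma (1 - 1 / \<alpha>\<^sub>2)) * tv_dist \<nu>\<^sub>1 \<nu>\<^sub>2"
      unfolding eq .
  qed
qed

end
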